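(* Let $M_1,\dots,M_k$ be $q$-matroids on nonzero finite-dimensional $\mathbb{F}_q$-vector spaces. Then $M_1\square\cdots\square M_k$ is maximal in the partially ordered set $(\mathcal{M}_q(M_1,\dots,M_k),\preceq)$; that is, if $N\in\mathcal{M}_q(M_1,\dots,M_k)$ and $M_1\square\cdots\square M_k\preceq N$, then $N\cong M_1\square\cdots\square M_k$.
   Context: For a finite-dimensional $\mathbb{F}_q$-space $E$, $\mathcal{L}(E)$ is its subspace lattice and $\mathbf{0}$ the zero space. A $q$-matroid $M=(E,r)$ is given by $r:\mathcal{L}(E)\to\mathbb{Z}$ with (R1) $0\le r(A)\le\dim(A)$; (R2) $A\le B\Rightarrow r(A)\le r(B)$; (R3) $r(A+B)+r(A\cap B)\le r(A)+r(B)$. $A$ is independent if $r(A)=\dim A$. $(E_1,r_1)\cong(E_2,r_2)$ means there is an $\mathbb{F}_q$-linear isomorphism $\tau:E_1\to E_2$ with $r_2(\tau(V))=r_1(V)$ for all $V\le E_1$. For $A\le B\le E$, the minor $M[A,B]$ is the $q$-matroid on $B/A$ with rank function $X/A\mapsto r(X)-r(A)$, $A\le X\le B$. Weak order: for $q$-matroids $N_1=(E_1,r_1)$, $N_2=(E_2,r_2)$, write $N_2\preceq N_1$ if there is a lattice isomorphism $\tau:\mathcal{L}(E_1)\to\mathcal{L}(E_2)$ with $r_1(X)\ge r_2(\tau(X))$ for all $X\in\mathcal{L}(E_1)$. $\mathcal{M}_q(M_1,\dots,M_k)$ is the set of (isomorphism classes of) $q$-matroids $M$ on a vector space $E$ for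 which there is a chain $\mathbf{0}=V_0<V_1<\dots<V_k=E$ with $M[V_{i-1},V_i]\cong M_i$ for all $i$, ordered by $\preceq$. Free product: for $q$-matroids $M_i=(E_i,r_i)$, $i=1,2$, with projections $\pi_i:E_1\oplus E_2\to E_i$ and embeddings $\iota_i:E_i\to E_1\oplus E_2$, put $\lambda_1(A)=r_1(E_1)-r_1(A)$ and $\nu_2(B)=\dim(B)-r_2(B)$. $M_1\square M_2$ is the $q$-matroid on $E_1\oplus E_2$ whose independent spaces are exactly the $I\le E_1\oplus E_2$ with $\pi_1(I\cap\iota_1(E_1))$ independent in $M_1$ and $\lambda_1(\pi_1(I\cap\iota_1(E_1)))\ge\nu_2(\pi_2(I))$. It is associative, so $M_1\square\cdots\square M_k$ is well defined. *)

theory Defs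
  imports "HOL-Algebra.AbelCoset" "Jordan_Normal_Form.Missing_VectorSpace"
begin

text \<open>A \<open>q\<close>-matroid \<open>(E, r)\<close>. Only the values of \<open>r\<close> on subspaces of \<open>E\<close> are meaningful.\<close>

type_synonym ('k, 'v) qmat = "('k, 'v) module \<times> ('v set \<Rightarrow> int)"

abbreviation space :: "('k, 'v) qmat \<Rightarrow> ('k, 'v) module" where
  "space M \<equiv> fst M"

abbreviation rk :: "('k, 'v) qmat \<Rightarrow> 'v set \<Rightarrow> int" where
  "rk M \<equiv> snd M"

definition sdim :: "('k, 'x) ring_scheme \<Rightarrow> ('k, 'v) module \<Rightarrow> 'v set \<Rightarrow> int" where
  "sdim K E A = int (vectorspace.dim K (E\<lparr>carrier := A\<rparr>))"

definition subspaces :: "('k, 'x) ring_scheme \<Rightarrow> ('k, 'v) module \<Rightarrow> 'v set set" where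
  "subspaces K E = {A. subspace K A E}"

definition q_matroid :: "('k, 'x) ring_scheme \<Rightarrow> ('k, 'v) qmat \<Rightarrow> bool" where
  "q_matroid K M \<longleftrightarrow>
     vectorspace K (space M) \<and> vectorspace.fin_dim K (space M) \<and>
     (\<forall>A \<in> subspaces K (space M). 0 \<le> rk M A \<and> rk M A \<le> sdim K (space M) A) \<and>
     (\<forall>A \<in> subspaces K (space M). \<forall>B \<in> subspaces K (space M).
        A \<subseteq> B \<longrightarrow> rk M A \<le> rk M B) \<and>
     (\<forall>A \<in> subspaces K (space M). \<forall>B \<in> subspaces K (space M).
        rk M (module.submodule_sum (space M) A B) + rk M (A \<inter> B) \<le> rk M A + rk M B)"

definition independent :: "('k, 'x) ring_scheme \<Rightarrow> ('k, 'v) qmat \<Rightarrow> 'v set \<Rightarrow> bool" where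
  "independent K M A \<longleftrightarrow> A \<in> subspaces K (space M) \<and> rk M A = sdim K (space M) A"

definition qm_iso ::
  "('k, 'x) ring_scheme \<Rightarrow> ('k, 'v) qmat \<Rightarrow> ('k, 'w) qmat \<Rightarrow> bool" where
  "qm_iso K M1 M2 \<longleftrightarrow>
     (\<exists>\<tau>. linear_map K (space M1) (space M2) \<tau> \<and>
          bij_betw \<tau> (carrier (space M1)) (carrier (space M2)) \<and>
          (\<forall>V \<in> subspaces K (space M1). rk M2 (\<tau> ` V) = rk M1 V))"

text \<open>The elements of \<open>E/A\<close> are the cosets of \<open>A\<close>; \<open>mult\<close> and \<open>one\<close> are
  irrelevant fields of the \<open>module\<close> record. If \<open>Y = X/A\<close>, then \<open>\<Union>Y = X\<close>, so the
  rank function of the minor is \<open>X/A \<mapsto> r(X) - r(A)\<close>.\<close>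

definition quotient_space :: "('k, 'v) module \<Rightarrow> 'v set \<Rightarrow> ('k, 'v set) module" where
  "quotient_space E A =
     \<lparr>carrier = a_rcosets\<^bsub>E\<^esub> A,
      mult = (\<lambda>X Y. A),
      one = A,
      zero = A,
      add = (\<lambda>X Y. X <+>\<^bsub>E\<^esub> Y),
      smult = (\<lambda>c X. \<Union>x\<in>X. A +>\<^bsub>E\<^esub> (c \<odot>\<^bsub>E\<^esub> x))\<rparr>"

definition minor :: "('k, 'v) qmat \<Rightarrow> 'v set \<Rightarrow> 'v set \<Rightarrow> ('k, 'v set) qmat" where
  "minor M A B =
     (quotient_space ((space M)\<lparr>carrier := B\<rparr>) A, \<lambda>Y. rk M (\<Union>Y) - rk M A)"

definition lattice_iso ::
  "('k, 'x) ring_scheme \<Rightarrow> ('k, 'v) module \<Rightarrow> ('k, 'w) module \<Rightarrow> ('v set \<Rightarrow> 'w set) \<Rightarrow> bool" where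
  "lattice_iso K E1 E2 \<tau> \<longleftrightarrow>
     bij_betw \<tau> (subspaces K E1) (subspaces K E2) \<and>
     (\<forall>A \<in> subspaces K E1. \<forall>B \<in> subspaces K E1.
        \<tau> (A \<inter> B) = \<tau> A \<inter> \<tau> B \<and>
        \<tau> (module.submodule_sum E1 A B) = module.submodule_sum E2 (\<tau> A) (\<tau> B))"

text \<open>\<open>weak_le K N2 N1\<close> is \<open>N2 \<preceq> N1\<close>; note that the lattice isomorphism goes from the
  larger \<open>q\<close>-matroid to the smaller one.\<close>

definition weak_le ::
  "('k, 'x) ring_scheme \<Rightarrow> ('k, 'w) qmat \<Rightarrow> ('k, 'v) qmat \<Rightarrow> bool" where
  "weak_le K N2 N1 \<longleftrightarrow>
     (\<exists>\<tau>. lattice_iso K (space N1) (space N2) \<tau> \<and>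
          (\<forall>X \<in> subspaces K (space N1). rk N1 X \<ge> rk N2 (\<tau> X)))"

text \<open>Isomorphism classes are represented by their members: the set below is closed under
  \<open>qm_iso\<close>, and \<open>weak_le\<close> respects \<open>qm_iso\<close>.\<close>

definition Mq :: "('k, 'x) ring_scheme \<Rightarrow> ('k, 'v) qmat list \<Rightarrow> ('k, 'w) qmat set" where
  "Mq K Ms = {N. q_matroid K N \<and>
     (\<exists>V :: nat \<Rightarrow> 'w set.
        V 0 = {\<zero>\<^bsub>space N\<^esub>} \<and> V (length Ms) = carrier (space N) \<and>
        (\<forall>i \<le> length Ms. V i \<in> subspaces K (space N)) \<and>
        (\<forall>i < length Ms. V i \<subset> V (Suc i) \<and>
           qm_iso K (minor N (V i) (V (Suc i))) (Ms ! i)))}"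

text \<open>\<open>fp_indep\<close> is the independence condition of the free product; here
  \<open>J\<close> is \<open>\<pi>\<^sub>1(I \<inter> \<iota>\<^sub>1(E\<^sub>1))\<close> and \<open>snd ` I\<close> is \<open>\<pi>\<^sub>2(I)\<close>.\<close>

definition rank_lack :: "('k, 'v) qmat \<Rightarrow> 'v set \<Rightarrow> int" where
  "rank_lack M A = rk M (carrier (space M)) - rk M A"

definition nullity :: "('k, 'x) ring_scheme \<Rightarrow> ('k, 'v) qmat \<Rightarrow> 'v set \<Rightarrow> int" where
  "nullity K M B = sdim K (space M) B - rk M B"

definition fp_indep ::
  "('k, 'x) ring_scheme \<Rightarrow> ('k, 'v) qmat \<Rightarrow> ('k, 'w) qmat \<Rightarrow> ('v \<times> 'w) set \<Rightarrow> bool" where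
  "fp_indep K M1 M2 I \<longleftrightarrow>
     (let J = fst ` (I \<inter> inj1 (space M1) (space M2) ` carrier (space M1))
      in independent K M1 J \<and> rank_lack M1 J \<ge> nullity K M2 (snd ` I))"

text \<open>The independent spaces of a \<open>q\<close>-matroid determine its rank function on all subspaces, so
  the choice below affects only the irrelevant values on sets that are not subspaces.\<close>

definition free_product ::
  "('k, 'x) ring_scheme \<Rightarrow> ('k, 'v) qmat \<Rightarrow> ('k, 'w) qmat \<Rightarrow> ('k, 'v \<times> 'w) qmat" where
  "free_product K M1 M2 =
     (let E = direct_sum (space M1) (space M2)
      in (E, SOME r. q_matroid K (E, r) \<and>
               (\<forall>I \<in> subspaces K E. independent K (E, r) I \<longleftrightarrow> fp_indep K M1 M2 I)))"

text \<open>The iterated product is bracketed to the right, and its ground space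
  \<open>E\<^sub>1 \<oplus> (E\<^sub>2 \<oplus> \<dots>)\<close> is realised on lists \<open>[x\<^sub>1, \<dots>, x\<^sub>k]\<close> with \<open>x\<^sub>i\<close> in \<open>E\<^sub>i\<close>, so that
  its type does not depend on the number of factors. \<open>transport f M\<close> is the copy of \<open>M\<close> along
  an injection \<open>f\<close>. The empty product is left unspecified.\<close>

definition transport :: "('v \<Rightarrow> 'w) \<Rightarrow> ('k, 'v) qmat \<Rightarrow> ('k, 'w) qmat" where
  "transport f M =
     (let g = inv_into UNIV f in
      (\<lparr>carrier = f ` carrier (space M),
       mult = (\<lambda>x y. f (g x \<otimes>\<^bsub>space M\<^esub> g y)),
       one = f \<one>\<^bsub>space M\<^esub>,
       zero = f \<zero>\<^bsub>space M\<^esub>,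
       add = (\<lambda>x y. f (g x \<oplus>\<^bsub>space M\<^esub> g y)),
       smult = (\<lambda>c x. f (c \<odot>\<^bsub>space M\<^esub> g x))\<rparr>,
      \<lambda>X. rk M (g ` X)))"

fun free_products ::
  "('k, 'x) ring_scheme \<Rightarrow> ('k, 'v) qmat list \<Rightarrow> ('k, 'v list) qmat" where
  "free_products K [M] = transport (\<lambda>x. [x]) M"
| "free_products K (M # M' # Ms) =
     transport (\<lambda>(x, xs). x # xs) (free_product K M (free_products K (M' # Ms)))"

end

theory Submission
  imports Defs
begin

text \<open>Let \<open>N\<close> have a chain with minors \<open>M\<^sub>1, \<dots>, M\<^sub>k\<close>. Splitting the chain by
  choosing complements gives a linear isomorphism \<open>h\<close> from \<open>N\<close> to the free product \<open>P\<close>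
  with \<open>r\<^sub>N(X) \<le> r\<^sub>P(h(X))\<close>. This is read off from the formula
  \<open>r(X) = min (r\<^sub>1(E\<^sub>1) + r\<^sub>2(\<pi>\<^sub>2 X)) (r\<^sub>1(X \<inter> E\<^sub>1) + dim (\<pi>\<^sub>2 X))\<close> for the rank function of a
  free product of two factors. If conversely a lattice isomorphism \<open>\<tau>\<close> satisfies
  \<open>r\<^sub>P(\<tau>(X)) \<le> r\<^sub>N(X)\<close>, then the sums of \<open>r\<^sub>N\<close> and \<open>r\<^sub>P\<close> over the finitely many subspaces
  agree, because both \<open>h\<close> and \<open>\<tau>\<close> are bijections between the subspaces of \<open>N\<close> and of \<open>P\<close>; so \<open>r\<^sub>N(X) = r\<^sub>P(h(X))\<close> for all \<open>X\<close>.
  Only the bijectivity of \<open>\<tau>\<close> enters.\<close>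

section \<open>Linear maps, subspaces and dimension\<close>

text \<open>The two terms of the minimum are bounds that every q-matroid with restriction
  \<open>M1\<close> to E1 and contraction \<open>M2\<close> by E1 obeys: r(X) \<le> r(X + E1) by
  monotonicity, and r(X) \<le> r(X \<inter> E1) + dim X - dim (X \<inter> E1) because rank grows no
  faster than dimension. The free product attains the smaller bound everywhere, so no such q-matroid
  exceeds it on any space. For more factors both bounds are applied at each step of the chain. The
  free product is given by choosing a rank function for prescribed independent spaces, so the
  formula does not come by definition: it must be shown to be a q-matroid with these independent
  spaces, and independent spaces must be shown to determine the rank. The isomorphism in the
  conclusion is linear, whereas a lattice isomorphism need not be induced by a linear map. It is
  therefore h that has to preserve rank, and the sums compare h with \<tau> without relating the two
  maps. Finite scalars make these sums finite.\<close>

lemma linear_mapI: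
  assumes "vectorspace K V" "vectorspace K W"
    and "\<And>x. x \<in> carrier V \<Longrightarrow> f x \<in> carrier W"
    and "\<And>x y. x \<in> carrier V \<Longrightarrow> y \<in> carrier V \<Longrightarrow> f (x \<oplus>\<^bsub>V\<^esub> y) = f x \<oplus>\<^bsub>W\<^esub> f y"
    and "\<And>c x. c \<in> carrier K \<Longrightarrow> x \<in> carrier V \<Longrightarrow> f (c \<odot>\<^bsub>V\<^esub> x) = c \<odot>\<^bsub>W\<^esub> f x"
  shows "linear_map K V W f"
  using assms
  by (auto simp: linear_map_def mod_hom_def mod_hom_axioms_def module_hom_def vectorspace_def)

lemma linear_mapD:
  assumes "linear_map K V W f"
  shows "vectorspace K V" "vectorspace K W"
    and "x \<in> carrier V \<Longrightarrow> f x \<in> carrier W"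
    and "x \<in> carrier V \<Longrightarrow> y \<in> carrier V \<Longrightarrow> f (x \<oplus>\<^bsub>V\<^esub> y) = f x \<oplus>\<^bsub>W\<^esub> f y"
    and "c \<in> carrier K \<Longrightarrow> x \<in> carrier V \<Longrightarrow> f (c \<odot>\<^bsub>V\<^esub> x) = c \<odot>\<^bsub>W\<^esub> f x"
    and "f \<zero>\<^bsub>V\<^esub> = \<zero>\<^bsub>W\<^esub>"
    and "x \<in> carrier V \<Longrightarrow> y \<in> carrier V \<Longrightarrow> f (x \<ominus>\<^bsub>V\<^esub> y) = f x \<ominus>\<^bsub>W\<^esub> f y"
proof -
  interpret linear_map K V W f by fact
  show "vectorspace K V" "vectorspace K W" by unfold_locales
  show "x \<in> carrier V \<Longrightarrow> f x \<in> carrier W"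
    "x \<in> carrier V \<Longrightarrow> y \<in> carrier V \<Longrightarrow> f (x \<oplus>\<^bsub>V\<^esub> y) = f x \<oplus>\<^bsub>W\<^esub> f y"
    "c \<in> carrier K \<Longrightarrow> x \<in> carrier V \<Longrightarrow> f (c \<odot>\<^bsub>V\<^esub> x) = c \<odot>\<^bsub>W\<^esub> f x"
    "f \<zero>\<^bsub>V\<^esub> = \<zero>\<^bsub>W\<^esub>"
    "x \<in> carrier V \<Longrightarrow> y \<in> carrier V \<Longrightarrow> f (x \<ominus>\<^bsub>V\<^esub> y) = f x \<ominus>\<^bsub>W\<^esub> f y"
    by auto
qed

lemma linear_map_comp:
  assumes f: "linear_map K U V f" and g: "linear_map K V W g"
  shows "linear_map K U W (\<lambda>x. g (f x))"
  using linear_mapD[OF f] linear_mapD[OF g] by (intro linear_mapI) auto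

lemma linear_map_inv_into:
  assumes f: "linear_map K V W f" and bij: "bij_betw f (carrier V) (carrier W)"
  shows "linear_map K W V (inv_into (carrier V) f)"
proof (rule linear_mapI)
  note D = linear_mapD[OF f]
  interpret V: vectorspace K V by (rule D)
  interpret W: vectorspace K W by (rule D)
  let ?g = "inv_into (carrier V) f"
  show gc: "\<And>x. x \<in> carrier W \<Longrightarrow> ?g x \<in> carrier V"
    using bij by (metis bij_betw_imp_surj_on inv_into_into)
  have fg: "\<And>x. x \<in> carrier W \<Longrightarrow> f (?g x) = x"
    using bij by (metis bij_betw_inv_into_right)
  have inj: "inj_on f (carrier V)" using bij by (rule bij_betw_imp_inj_on)
  show "?g (x \<oplus>\<^bsub>W\<^esub> y) = ?g x \<oplus>\<^bsub>V\<^esub> ?g y" if "x \<in> carrier W" "y \<in> carrier W" for x y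
    using that by (intro inj_onD[OF inj]) (auto simp: fg gc D)
  show "?g (c \<odot>\<^bsub>W\<^esub> x) = c \<odot>\<^bsub>V\<^esub> ?g x" if "c \<in> carrier K" "x \<in> carrier W" for c x
    using that by (intro inj_onD[OF inj]) (auto simp: fg gc D)
qed (use linear_mapD[OF f] in auto)

text \<open>The axioms transfer to \<open>V\<close> because \<open>f\<close> is injective and they
  hold after applying \<open>f\<close>. The spaces built as bare records, quotients and transported
  copies, become vector spaces in this way instead of by checking every axiom on their
  operations.\<close>

lemma vectorspace_pullback:
  assumes W: "vectorspace K W" and bij: "bij_betw f (carrier V) (carrier W)"
    and add: "\<And>x y. x \<in> carrier V \<Longrightarrow> y \<in> carrier V \<Longrightarrow>
      x \<oplus>\<^bsub>V\<^esub> y \<in> carrier V \<and> f (x \<oplus>\<^bsub>V\<^esub> y) = f x \<oplus>\<^bsub>W\<^esub> f y"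
    and smult: "\<And>c x. c \<in> carrier K \<Longrightarrow> x \<in> carrier V \<Longrightarrow>
      c \<odot>\<^bsub>V\<^esub> x \<in> carrier V \<and> f (c \<odot>\<^bsub>V\<^esub> x) = c \<odot>\<^bsub>W\<^esub> f x"
    and zero: "\<zero>\<^bsub>V\<^esub> \<in> carrier V" "f \<zero>\<^bsub>V\<^esub> = \<zero>\<^bsub>W\<^esub>"
  shows "linear_map K V W f"
proof -
  interpret W: vectorspace K W by fact
  have inj: "x = y" if "f x = f y" "x \<in> carrier V" "y \<in> carrier V" for x y
    using bij that by (metis bij_betw_imp_inj_on inj_onD)
  have fc: "f x \<in> carrier W" if "x \<in> carrier V" for x
    using bij that by (metis bij_betwE)
  have surj: "\<exists>x \<in> carrier V. f x = y" if "y \<in> carrier W" for y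
    using bij that by (metis bij_betw_imp_surj_on imageE)
  have "vectorspace K V"
  proof (rule vs_criteria)
    show "field K" ..
    show "\<forall>v\<in>carrier V. \<exists>w\<in>carrier V. v \<oplus>\<^bsub>V\<^esub> w = \<zero>\<^bsub>V\<^esub>"
    proof
      fix v assume v: "v \<in> carrier V"
      obtain w where w: "w \<in> carrier V" "f w = \<ominus>\<^bsub>W\<^esub> f v"
        using surj[of "\<ominus>\<^bsub>W\<^esub> f v"] fc[OF v] by auto
      have "v \<oplus>\<^bsub>V\<^esub> w = \<zero>\<^bsub>V\<^esub>"
        by (rule inj) (use v w fc[OF v] in \<open>auto simp: add zero W.r_neg\<close>)
      then show "\<exists>w\<in>carrier V. v \<oplus>\<^bsub>V\<^esub> w = \<zero>\<^bsub>V\<^esub>" using w by auto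
    qed
  next
    show "\<forall>v w x. v \<in> carrier V \<and> w \<in> carrier V \<and> x \<in> carrier V \<longrightarrow>
        v \<oplus>\<^bsub>V\<^esub> w \<oplus>\<^bsub>V\<^esub> x = v \<oplus>\<^bsub>V\<^esub> (w \<oplus>\<^bsub>V\<^esub> x)"
      using add fc by (auto intro!: inj simp: W.a_assoc)
    show "\<forall>v w. v \<in> carrier V \<and> w \<in> carrier V \<longrightarrow> v \<oplus>\<^bsub>V\<^esub> w = w \<oplus>\<^bsub>V\<^esub> v"
      using add fc by (auto intro!: inj simp: W.a_comm)
    show "\<forall>a b v. a \<in> carrier K \<and> b \<in> carrier K \<and> v \<in> carrier V \<longrightarrow>
        (a \<otimes>\<^bsub>K\<^esub> b) \<odot>\<^bsub>V\<^esub> v = a \<odot>\<^bsub>V\<^esub> (b \<odot>\<^bsub>V\<^esub> v)"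
      using smult fc by (auto intro!: inj simp: W.smult_assoc1)
    show "\<forall>a b v. a \<in> carrier K \<and> b \<in> carrier K \<and> v \<in> carrier V \<longrightarrow>
        (a \<oplus>\<^bsub>K\<^esub> b) \<odot>\<^bsub>V\<^esub> v = a \<odot>\<^bsub>V\<^esub> v \<oplus>\<^bsub>V\<^esub> b \<odot>\<^bsub>V\<^esub> v"
      using add smult fc by (auto intro!: inj simp: W.smult_l_distr)
    show "\<forall>a v w. a \<in> carrier K \<and> v \<in> carrier V \<and> w \<in> carrier V \<longrightarrow>
        a \<odot>\<^bsub>V\<^esub> (v \<oplus>\<^bsub>V\<^esub> w) = a \<odot>\<^bsub>V\<^esub> v \<oplus>\<^bsub>V\<^esub> a \<odot>\<^bsub>V\<^esub> w"
      using add smult fc by (auto intro!: inj simp: W.smult_r_distr)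
    show "\<forall>v\<in>carrier V. v \<oplus>\<^bsub>V\<^esub> \<zero>\<^bsub>V\<^esub> = v"
      using add zero fc by (auto intro!: inj)
    show "\<forall>v\<in>carrier V. \<one>\<^bsub>K\<^esub> \<odot>\<^bsub>V\<^esub> v = v"
      using smult fc by (auto intro!: inj)
  qed (use add smult zero in auto)
  then show ?thesis
    by (rule linear_mapI[OF _ W]) (use add smult fc in auto)
qed

text \<open>\<^const>\<open>subspaces\<close> is typed for module records without extension fields, whereas
  \<^locale>\<open>vectorspace\<close> allows them.\<close>

locale plain_vectorspace = vectorspace K V
  for K :: "('k, 'x) ring_scheme" and V :: "('k, 'v) module"

lemma plain_vectorspace_iff: "plain_vectorspace K V \<longleftrightarrow> vectorspace K V"
  by (simp add: plain_vectorspace_def)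

locale finite_vectorspace = plain_vectorspace +
  assumes finite_scalars: "finite (carrier K)" and finite_carrier: "finite (carrier V)"

lemma subspaces_iff:
  assumes "vectorspace K E"
  shows "A \<in> subspaces K E \<longleftrightarrow> A \<subseteq> carrier E \<and> \<zero>\<^bsub>E\<^esub> \<in> A \<and>
    (\<forall>x\<in>A. \<forall>y\<in>A. x \<oplus>\<^bsub>E\<^esub> y \<in> A) \<and> (\<forall>c\<in>carrier K. \<forall>x\<in>A. c \<odot>\<^bsub>E\<^esub> x \<in> A)"
  using assms by (auto simp: subspaces_def subspace_def submodule_def vectorspace_def)

context plain_vectorspace
begin

lemma subspacesI:
  assumes "A \<subseteq> carrier V" "\<zero>\<^bsub>V\<^esub> \<in> A" "\<And>x y. x \<in> A \<Longrightarrow> y \<in> A \<Longrightarrow> x \<oplus>\<^bsub>V\<^esub> y \<in> A"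
    "\<And>c x. c \<in> carrier K \<Longrightarrow> x \<in> A \<Longrightarrow> c \<odot>\<^bsub>V\<^esub> x \<in> A"
  shows "A \<in> subspaces K V"
  using assms by (auto simp: subspaces_iff[OF vectorspace_axioms])

lemma subspacesD:
  assumes "A \<in> subspaces K V"
  shows "A \<subseteq> carrier V" "\<zero>\<^bsub>V\<^esub> \<in> A" "x \<in> A \<Longrightarrow> y \<in> A \<Longrightarrow> x \<oplus>\<^bsub>V\<^esub> y \<in> A"
    "c \<in> carrier K \<Longrightarrow> x \<in> A \<Longrightarrow> c \<odot>\<^bsub>V\<^esub> x \<in> A"
    "x \<in> A \<Longrightarrow> y \<in> A \<Longrightarrow> x \<ominus>\<^bsub>V\<^esub> y \<in> A"
    "x \<in> A \<Longrightarrow> x \<in> carrier V"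
    "x \<in> A \<Longrightarrow> \<ominus>\<^bsub>V\<^esub> x \<in> A"
proof -
  note A = assms[unfolded subspaces_iff[OF vectorspace_axioms]]
  show "A \<subseteq> carrier V" "\<zero>\<^bsub>V\<^esub> \<in> A" "x \<in> A \<Longrightarrow> y \<in> A \<Longrightarrow> x \<oplus>\<^bsub>V\<^esub> y \<in> A"
    "c \<in> carrier K \<Longrightarrow> x \<in> A \<Longrightarrow> c \<odot>\<^bsub>V\<^esub> x \<in> A" "x \<in> A \<Longrightarrow> x \<in> carrier V"
    using A by auto
  show neg: "\<ominus>\<^bsub>V\<^esub> x \<in> A" if "x \<in> A" for x
    using A that by (metis R.add.inv_closed R.one_closed smult_minus_1 subsetD)
  show "x \<in> A \<Longrightarrow> y \<in> A \<Longrightarrow> x \<ominus>\<^bsub>V\<^esub> y \<in> A"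
    using A neg by (auto simp: a_minus_def)
qed

lemma carrier_in_subspaces: "carrier V \<in> subspaces K V"
  by (rule subspacesI) auto

lemma zero_in_subspaces: "{\<zero>\<^bsub>V\<^esub>} \<in> subspaces K V"
  by (rule subspacesI) auto

lemma Int_in_subspaces:
  "A \<in> subspaces K V \<Longrightarrow> B \<in> subspaces K V \<Longrightarrow> A \<inter> B \<in> subspaces K V"
  by (rule subspacesI) (auto dest: subspacesD)

lemma subspace_sum_eq: "subspace_sum A B = {x \<oplus>\<^bsub>V\<^esub> y | x y. x \<in> A \<and> y \<in> B}"
  by (auto simp: submodule_sum_def)

lemma subspace_sum_in_subspaces:
  "A \<in> subspaces K V \<Longrightarrow> B \<in> subspaces K V \<Longrightarrow> subspace_sum A B \<in> subspaces K V"
  by (simp add: subspaces_def sum_is_subspace)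

lemma subspace_sum_upper:
  assumes "A \<in> subspaces K V" "B \<in> subspaces K V"
  shows "A \<subseteq> subspace_sum A B" "B \<subseteq> subspace_sum A B"
proof -
  have *: "subspace K A V" "subspace K B V" using assms by (auto simp: subspaces_def)
  show "A \<subseteq> subspace_sum A B" by (rule in_sum_vs[OF *])
  show "B \<subseteq> subspace_sum A B" using in_sum_vs[OF *(2,1)] vsum_comm[OF *] by simp
qed

lemma subspace_sum_least:
  assumes "A \<subseteq> C" "B \<subseteq> C" "C \<in> subspaces K V"
  shows "subspace_sum A B \<subseteq> C"
  using assms by (auto simp: subspace_sum_eq dest: subspacesD)

lemma subspace_is_vectorspace: "A \<in> subspaces K V \<Longrightarrow> vectorspace K (V\<lparr>carrier := A\<rparr>)"
  by (simp add: subspaces_def subspace_is_vs)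

lemma subspaces_restrict:
  assumes "B \<in> subspaces K V"
  shows "A \<in> subspaces K (V\<lparr>carrier := B\<rparr>) \<longleftrightarrow> A \<in> subspaces K V \<and> A \<subseteq> B"
  using subspacesD[OF assms]
  by (auto simp: subspaces_iff[OF vectorspace_axioms] subspaces_iff[OF subspace_is_vectorspace[OF assms]])

end

lemma linear_map_restrict:
  assumes f: "linear_map K V W f" and A: "A \<in> subspaces K V"
  shows "linear_map K (V\<lparr>carrier := A\<rparr>) W f"
proof -
  interpret V: plain_vectorspace K V unfolding plain_vectorspace_iff using f by (rule linear_mapD)
  show ?thesis
    by (rule linear_mapI) (use linear_mapD[OF f] V.subspacesD[OF A] V.subspace_is_vectorspace[OF A] in auto)
qed

lemma image_in_subspaces:
  assumes f: "linear_map K V W f" and A: "A \<in> subspaces K V"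
  shows "f ` A \<in> subspaces K W"
proof -
  note D = linear_mapD[OF f]
  interpret V: plain_vectorspace K V unfolding plain_vectorspace_iff by (rule D)
  interpret W: plain_vectorspace K W unfolding plain_vectorspace_iff by (rule D)
  note A = V.subspacesD[OF A]
  show ?thesis
  proof (rule W.subspacesI)
    fix x y assume "x \<in> f ` A" "y \<in> f ` A"
    then obtain u v where uv: "u \<in> A" "v \<in> A" "x = f u" "y = f v" by auto
    then have "x \<oplus>\<^bsub>W\<^esub> y = f (u \<oplus>\<^bsub>V\<^esub> v)" using A D by auto
    then show "x \<oplus>\<^bsub>W\<^esub> y \<in> f ` A" using uv A by auto
  next
    fix c x assume c: "c \<in> carrier K" and "x \<in> f ` A"
    then obtain u where u: "u \<in> A" "x = f u" by auto
    then have "c \<odot>\<^bsub>W\<^esub> x = f (c \<odot>\<^bsub>V\<^esub> u)" using A D c by auto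
    then show "c \<odot>\<^bsub>W\<^esub> x \<in> f ` A" using u A c by auto
  next
    show "\<zero>\<^bsub>W\<^esub> \<in> f ` A" using A(2) D(6) by (metis imageI)
  qed (use A D in auto)
qed

lemma vimage_in_subspaces:
  assumes f: "linear_map K V W f" and B: "B \<in> subspaces K W"
  shows "{x \<in> carrier V. f x \<in> B} \<in> subspaces K V"
proof -
  note D = linear_mapD[OF f]
  interpret V: plain_vectorspace K V unfolding plain_vectorspace_iff by (rule D)
  interpret W: plain_vectorspace K W unfolding plain_vectorspace_iff by (rule D)
  show ?thesis
    by (rule V.subspacesI) (use W.subspacesD[OF B] D in auto)
qed

lemma kernel_in_subspaces:
  fixes W :: "('k, 'w) module"
  assumes "linear_map K V W f"
  shows "{x \<in> carrier V. f x = \<zero>\<^bsub>W\<^esub>} \<in> subspaces K V"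
proof -
  interpret W: plain_vectorspace K W
    unfolding plain_vectorspace_iff using assms by (rule linear_mapD)
  show ?thesis using vimage_in_subspaces[OF assms W.zero_in_subspaces] by simp
qed

lemma sdim_restrict [simp]: "sdim K (E\<lparr>carrier := B\<rparr>) A = sdim K E A"
  by (simp add: sdim_def)

lemma sdim_nonneg [simp]: "0 \<le> sdim K E A"
  by (simp add: sdim_def)

section \<open>Dimension in a finite space, obtained by counting vectors\<close>

context finite_vectorspace
begin

lemma finite_subspace: "A \<in> subspaces K V \<Longrightarrow> finite A"
  using subspacesD(1) finite_carrier finite_subset by blast

lemma finite_subspaces: "finite (subspaces K V)"
  by (rule finite_subset[of _ "Pow (carrier V)"]) (use subspacesD(1) finite_carrier in auto)

lemma fin_dim: fin_dim
proof -
  have "span (carrier V) = carrier V"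
    using in_own_span[of "carrier V"] by (intro equalityI subsetI) (auto elim: span_closed[rotated])
  then show ?thesis
    unfolding fin_dim_def using finite_carrier by (intro exI[of _ "carrier V"]) simp
qed

lemma subspace_is_finite_vectorspace:
  assumes "A \<in> subspaces K V"
  shows "finite_vectorspace K (V\<lparr>carrier := A\<rparr>)"
  using subspace_is_vectorspace[OF assms] finite_subspace[OF assms] finite_scalars
  by (simp add: finite_vectorspace_def plain_vectorspace_iff finite_vectorspace_axioms_def)

text \<open>Coordinates in a basis identify the space with tuples of scalars. Since there are at
  least two scalars, powers are strictly increasing in the exponent, and comparing dimensions
  becomes comparing cardinalities.\<close>

lemma card_carrier: "card (carrier V) = card (carrier K) ^ dim"
proof -
  obtain B where B: "finite B" "basis B" using finite_basis_exists[OF fin_dim] by auto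
  have BV: "B \<subseteq> carrier V" using B by (simp add: basis_def)
  have ex1: "\<And>v. v \<in> carrier V \<Longrightarrow> \<exists>!a. a \<in> B \<rightarrow>\<^sub>E carrier K \<and> lincomb a B = v"
    using basis_criterion[OF B(1) BV] B(2) by auto
  have "bij_betw (\<lambda>a. lincomb a B) (B \<rightarrow>\<^sub>E carrier K) (carrier V)"
    unfolding bij_betw_def
  proof
    have lc: "lincomb a B \<in> carrier V" if "a \<in> B \<rightarrow>\<^sub>E carrier K" for a
      using that BV by (intro lincomb_closed) auto
    then show "inj_on (\<lambda>a. lincomb a B) (B \<rightarrow>\<^sub>E carrier K)"
      using ex1 by (intro inj_onI) metis
    show "(\<lambda>a. lincomb a B) ` (B \<rightarrow>\<^sub>E carrier K) = carrier V"
      using lc ex1 by (auto simp: image_iff) metis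
  qed
  then have "card (carrier V) = card (B \<rightarrow>\<^sub>E carrier K)"
    by (rule bij_betw_same_card[symmetric])
  also have "\<dots> = card (carrier K) ^ card B"
    by (simp add: card_PiE[OF B(1)])
  finally show ?thesis by (simp only: dim_basis[OF B])
qed

lemma card_scalars: "card (carrier K) > 1"
proof -
  have "card {\<zero>\<^bsub>K\<^esub>, \<one>\<^bsub>K\<^esub>} \<le> card (carrier K)"
    using finite_scalars by (intro card_mono) auto
  then show ?thesis by auto
qed

lemma card_subspace:
  assumes "A \<in> subspaces K V"
  shows "card A = card (carrier K) ^ nat (sdim K V A)"
  using finite_vectorspace.card_carrier[OF subspace_is_finite_vectorspace[OF assms]]
  by (simp add: sdim_def)

lemma sdim_le_iff:
  assumes "A \<in> subspaces K V" "B \<in> subspaces K V"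
  shows "sdim K V A \<le> sdim K V B \<longleftrightarrow> card A \<le> card B"
  unfolding card_subspace[OF assms(1)] card_subspace[OF assms(2)]
    power_increasing_iff[OF card_scalars]
  by (rule nat_le_eq_zle[symmetric]) simp

lemma sdim_mono:
  assumes "A \<in> subspaces K V" "B \<in> subspaces K V" "A \<subseteq> B"
  shows "sdim K V A \<le> sdim K V B"
  using assms by (simp add: sdim_le_iff card_mono finite_subspace)

lemma sdim_zero: "sdim K V {\<zero>\<^bsub>V\<^esub>} = 0"
proof -
  have "card {\<zero>\<^bsub>V\<^esub>} = 1" by simp
  then have "card (carrier K) ^ nat (sdim K V {\<zero>\<^bsub>V\<^esub>}) = 1"
    unfolding card_subspace[OF zero_in_subspaces] .
  then have "nat (sdim K V {\<zero>\<^bsub>V\<^esub>}) = 0"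
    using one_less_power[OF card_scalars] by (rule_tac ccontr) fastforce
  then show ?thesis by (simp add: sdim_def)
qed

text \<open>Rank-nullity for the restriction of \<open>f\<close> to \<open>A\<close>. The later
  dimension formulas (injective images, direct sums, sum and intersection) are instances of it for
  suitable maps.\<close>

lemma sdim_rank_nullity:
  assumes f: "linear_map K V W f" and A: "A \<in> subspaces K V"
  shows "sdim K V A = sdim K W (f ` A) + sdim K V {x \<in> A. f x = \<zero>\<^bsub>W\<^esub>}"
proof -
  interpret A: finite_vectorspace K "V\<lparr>carrier := A\<rparr>"
    by (rule subspace_is_finite_vectorspace[OF A])
  interpret l: linear_map K "V\<lparr>carrier := A\<rparr>" W f
    by (rule linear_map_restrict[OF f A])
  show ?thesis
    using l.rank_nullity[OF A.fin_dim] by (simp add: sdim_def l.im_def l.ker_def)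
qed

lemma sdim_inj_image:
  assumes f: "linear_map K V W f" and A: "A \<in> subspaces K V" and "inj_on f A"
  shows "sdim K W (f ` A) = sdim K V A"
proof -
  have "{x \<in> A. f x = \<zero>\<^bsub>W\<^esub>} = {\<zero>\<^bsub>V\<^esub>}"
  proof (intro equalityI subsetI)
    fix x assume "x \<in> {x \<in> A. f x = \<zero>\<^bsub>W\<^esub>}"
    then have "x = \<zero>\<^bsub>V\<^esub>"
      using inj_onD[OF assms(3), of x "\<zero>\<^bsub>V\<^esub>"] subspacesD(2)[OF A] linear_mapD(6)[OF f] by simp
    then show "x \<in> {\<zero>\<^bsub>V\<^esub>}" by simp
  next
    fix x assume "x \<in> {\<zero>\<^bsub>V\<^esub>}"
    then show "x \<in> {x \<in> A. f x = \<zero>\<^bsub>W\<^esub>}"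
      using subspacesD(2)[OF A] linear_mapD(6)[OF f] by simp
  qed
  then show ?thesis using sdim_rank_nullity[OF f A] sdim_zero by simp
qed

end

section \<open>Direct sums, complements and extension of linear maps\<close>

lemma linear_map_fst:
  assumes "vectorspace K V" "vectorspace K W"
  shows "linear_map K (direct_sum V W) V fst"
  by (rule linear_mapI) (use assms in \<open>auto simp: direct_sum_is_vs\<close>, auto simp: direct_sum_def)

lemma linear_map_snd:
  assumes "vectorspace K V" "vectorspace K W"
  shows "linear_map K (direct_sum V W) W snd"
  by (rule linear_mapI) (use assms in \<open>auto simp: direct_sum_is_vs\<close>, auto simp: direct_sum_def)

lemma linear_map_pair:
  assumes f: "linear_map K U V f" and g: "linear_map K U W g"
  shows "linear_map K U (direct_sum V W) (\<lambda>x. (f x, g x))"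
  by (rule linear_mapI)
    (use linear_mapD[OF f] linear_mapD[OF g] direct_sum_is_vs[of K V W] in \<open>auto simp: direct_sum_def\<close>)

lemma carrier_direct_sum [simp]: "carrier (direct_sum V W) = carrier V \<times> carrier W"
  by (simp add: direct_sum_def)

lemma zero_direct_sum [simp]: "\<zero>\<^bsub>direct_sum V W\<^esub> = (\<zero>\<^bsub>V\<^esub>, \<zero>\<^bsub>W\<^esub>)"
  by (simp add: direct_sum_def)

lemma finite_vectorspace_direct_sum:
  assumes "finite_vectorspace K V" "finite_vectorspace K W"
  shows "finite_vectorspace K (direct_sum V W)"
  using assms direct_sum_is_vs[of K V W]
  by (simp add: finite_vectorspace_def plain_vectorspace_iff finite_vectorspace_axioms_def)

text \<open>The space \<open>J\<close> of \<open>fp_indep\<close>. Up to the embedding of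
  \<open>V\<close> it is the kernel of \<open>snd\<close> on \<open>X\<close>, which is why it
  appears together with the image of \<open>X\<close> under \<open>snd\<close>.\<close>

definition left_part :: "('k, 'v) module \<Rightarrow> ('k, 'w) module \<Rightarrow> ('v \<times> 'w) set \<Rightarrow> 'v set" where
  "left_part V W X = fst ` (X \<inter> inj1 V W ` carrier V)"

lemma mem_left_part_iff: "x \<in> left_part V W X \<longleftrightarrow> x \<in> carrier V \<and> (x, \<zero>\<^bsub>W\<^esub>) \<in> X"
  by (force simp: left_part_def inj1_def)

lemma left_part_in_subspaces:
  assumes V: "vectorspace K V" and W: "vectorspace K W" and X: "X \<in> subspaces K (direct_sum V W)"
  shows "left_part V W X \<in> subspaces K V"
proof -
  have "left_part V W X = {x \<in> carrier V. inj1 V W x \<in> X}"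
    by (auto simp: mem_left_part_iff inj1_def)
  then show ?thesis using vimage_in_subspaces[OF inj1_linear[OF V W] X] by simp
qed

text \<open>Rank-nullity for \<open>snd\<close> on \<open>X\<close>, whose kernel is the embedded
  copy of the left part.\<close>

lemma sdim_direct_sum:
  assumes V: "finite_vectorspace K V" and W: "finite_vectorspace K W"
    and X: "X \<in> subspaces K (direct_sum V W)"
  shows "sdim K (direct_sum V W) X = sdim K V (left_part V W X) + sdim K W (snd ` X)"
proof -
  interpret V: finite_vectorspace K V by fact
  interpret W: finite_vectorspace K W by fact
  interpret D: finite_vectorspace K "direct_sum V W"
    by (rule finite_vectorspace_direct_sum) fact+
  note vs = V.vectorspace_axioms W.vectorspace_axioms
  have "{p \<in> X. snd p = \<zero>\<^bsub>W\<^esub>} = inj1 V W ` left_part V W X"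
    using D.subspacesD(1)[OF X] by (force simp: mem_left_part_iff inj1_def image_iff)
  moreover have "sdim K (direct_sum V W) (inj1 V W ` left_part V W X) = sdim K V (left_part V W X)"
    by (rule V.sdim_inj_image[OF inj1_linear[OF vs] left_part_in_subspaces[OF vs X]])
      (auto simp: inj1_def inj_on_def)
  ultimately show ?thesis
    using D.sdim_rank_nullity[OF linear_map_snd[OF vs] X] by simp
qed

context finite_vectorspace
begin

text \<open>Rank-nullity for the addition map from the direct sum of \<open>A\<close> and
  \<open>B\<close> to \<open>V\<close>: its image is the sum, and its kernel is an antidiagonal copy
  of the intersection.\<close>

lemma sdim_subspace_sum:
  assumes A: "A \<in> subspaces K V" and B: "B \<in> subspaces K V"
  shows "sdim K V (subspace_sum A B) + sdim K V (A \<inter> B) = sdim K V A + sdim K V B"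
proof -
  define D where "D = direct_sum (V\<lparr>carrier := A\<rparr>) (V\<lparr>carrier := B\<rparr>)"
  define s where "s = (\<lambda>p. fst p \<oplus>\<^bsub>V\<^esub> snd p)"
  note A' = subspacesD[OF A] and B' = subspacesD[OF B]
  have fA: "finite_vectorspace K (V\<lparr>carrier := A\<rparr>)" and fB: "finite_vectorspace K (V\<lparr>carrier := B\<rparr>)"
    using A B subspace_is_finite_vectorspace by blast+
  interpret D: finite_vectorspace K D
    unfolding D_def by (rule finite_vectorspace_direct_sum[OF fA fB])
  have s: "linear_map K D V s"
    unfolding D_def s_def using A B by (intro sum_map_linear) (simp_all add: subspaces_def)
  define Z where "Z = {p \<in> A \<times> B. s p = \<zero>\<^bsub>V\<^esub>}"
  have Z: "Z \<in> subspaces K D"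
    using kernel_in_subspaces[OF s] by (simp add: Z_def D_def)
  have AB: "A \<times> B \<in> subspaces K D"
    using D.carrier_in_subspaces by (simp add: D_def)
  have "sdim K D (A \<times> B) = sdim K V (s ` (A \<times> B)) + sdim K D Z"
    using D.sdim_rank_nullity[OF s AB] by (simp add: Z_def)
  moreover have "s ` (A \<times> B) = subspace_sum A B"
    by (auto simp: s_def subspace_sum_eq image_iff; blast)
  moreover have "sdim K D (A \<times> B) = sdim K V A + sdim K V B"
  proof -
    have "left_part (V\<lparr>carrier := A\<rparr>) (V\<lparr>carrier := B\<rparr>) (A \<times> B) = A"
      using B'(2) by (simp add: set_eq_iff mem_left_part_iff)
    moreover have "snd ` (A \<times> B) = B" using A'(2) by auto
    ultimately show ?thesis
      using sdim_direct_sum[OF fA fB AB[unfolded D_def]] by (simp add: D_def)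
  qed
  \<comment> \<open>The kernel consists of the pairs (-y, y) with y in both spaces. Such a pair is
    determined by its second entry, so the left part vanishes and the projection to the second entry
    carries the whole dimension.\<close>
  moreover have "sdim K D Z = sdim K V (A \<inter> B)"
  proof -
    have "left_part (V\<lparr>carrier := A\<rparr>) (V\<lparr>carrier := B\<rparr>) Z = {\<zero>\<^bsub>V\<^esub>}"
      using A'(2,6) B'(2) by (auto simp: mem_left_part_iff Z_def s_def)
    moreover have "snd ` Z = A \<inter> B"
    proof (intro equalityI subsetI)
      fix y assume "y \<in> snd ` Z"
      then obtain x where x: "x \<in> A" "y \<in> B" "x \<oplus>\<^bsub>V\<^esub> y = \<zero>\<^bsub>V\<^esub>" by (auto simp: Z_def s_def)
      then have "y = \<ominus>\<^bsub>V\<^esub> x"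
        using A'(6) B'(6) by (metis M.minus_equality M.a_comm)
      then show "y \<in> A \<inter> B" using x A'(7) by auto
    next
      fix y assume y: "y \<in> A \<inter> B"
      then have "(\<ominus>\<^bsub>V\<^esub> y, y) \<in> Z"
        using A'(7)[of y] A'(6)[of y] by (auto simp: Z_def s_def M.l_neg)
      then show "y \<in> snd ` Z" by force
    qed
    ultimately show ?thesis
      using sdim_direct_sum[OF fA fB Z[unfolded D_def]] sdim_zero by (simp add: D_def)
  qed
  ultimately show ?thesis by simp
qed

definition line :: "'c \<Rightarrow> 'c set" where
  "line x = (\<lambda>c. c \<odot>\<^bsub>V\<^esub> x) ` carrier K"

lemma line_in_subspaces:
  assumes x: "x \<in> carrier V"
  shows "line x \<in> subspaces K V"
proof (rule subspacesI)
  show "line x \<subseteq> carrier V" using x by (auto simp: line_def)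
  have "\<zero>\<^bsub>V\<^esub> = \<zero>\<^bsub>K\<^esub> \<odot>\<^bsub>V\<^esub> x" using x by simp
  then show "\<zero>\<^bsub>V\<^esub> \<in> line x" unfolding line_def by blast
next
  fix u v assume "u \<in> line x" "v \<in> line x"
  then obtain a b where "a \<in> carrier K" "b \<in> carrier K" "u = a \<odot>\<^bsub>V\<^esub> x" "v = b \<odot>\<^bsub>V\<^esub> x"
    by (auto simp: line_def)
  then have "u \<oplus>\<^bsub>V\<^esub> v = (a \<oplus>\<^bsub>K\<^esub> b) \<odot>\<^bsub>V\<^esub> x" "a \<oplus>\<^bsub>K\<^esub> b \<in> carrier K"
    using x by (auto simp: smult_l_distr)
  then show "u \<oplus>\<^bsub>V\<^esub> v \<in> line x" unfolding line_def by blast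
next
  fix c u assume "c \<in> carrier K" "u \<in> line x"
  then obtain a where "a \<in> carrier K" "u = a \<odot>\<^bsub>V\<^esub> x" by (auto simp: line_def)
  then have "c \<odot>\<^bsub>V\<^esub> u = (c \<otimes>\<^bsub>K\<^esub> a) \<odot>\<^bsub>V\<^esub> x" "c \<otimes>\<^bsub>K\<^esub> a \<in> carrier K"
    using x \<open>c \<in> carrier K\<close> by (auto simp: smult_assoc1)
  then show "c \<odot>\<^bsub>V\<^esub> u \<in> line x" unfolding line_def by blast
qed

lemma mem_line:
  assumes "x \<in> carrier V"
  shows "x \<in> line x"
proof -
  have "x = \<one>\<^bsub>K\<^esub> \<odot>\<^bsub>V\<^esub> x" using assms by simp
  then show ?thesis unfolding line_def by blast
qed

lemma sdim_line_le:
  assumes x: "x \<in> carrier V"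
  shows "sdim K V (line x) \<le> 1"
proof -
  have "card (line x) \<le> card (carrier K) ^ 1"
    unfolding line_def using card_image_le[OF finite_scalars] by simp
  then have "nat (sdim K V (line x)) \<le> 1"
    unfolding card_subspace[OF line_in_subspaces[OF x]] power_increasing_iff[OF card_scalars] .
  then show ?thesis by simp
qed

text \<open>Among the finitely many subspaces of \<open>B\<close> that meet \<open>A\<close> only in
  zero, take a maximal \<open>C\<close>. A vector of \<open>B\<close> outside \<open>A + C\<close>
  could be adjoined to \<open>C\<close> without creating an intersection with
  \<open>A\<close>.\<close>

lemma complement_exists:
  assumes A: "A \<in> subspaces K V" and B: "B \<in> subspaces K V" and AB: "A \<subseteq> B"
  obtains C where "C \<in> subspaces K V" "A \<inter> C = {\<zero>\<^bsub>V\<^esub>}" "subspace_sum A C = B"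
proof -
  let ?S = "{C \<in> subspaces K V. C \<subseteq> B \<and> A \<inter> C = {\<zero>\<^bsub>V\<^esub>}}"
  have fin: "finite ?S" using finite_subspaces by simp
  have "{\<zero>\<^bsub>V\<^esub>} \<in> ?S"
    using zero_in_subspaces subspacesD(2)[OF A] subspacesD(2)[OF B] by auto
  then obtain C where C: "C \<in> ?S" and max: "\<And>C'. C' \<in> ?S \<Longrightarrow> C \<subseteq> C' \<Longrightarrow> C' = C"
    using finite_has_maximal[OF fin] by (metis (no_types, lifting) empty_iff)
  then have C': "C \<in> subspaces K V" "C \<subseteq> B" "A \<inter> C = {\<zero>\<^bsub>V\<^esub>}" by auto
  note CD = subspacesD[OF C'(1)] and AD = subspacesD[OF A] and BD = subspacesD[OF B]
  have AC: "subspace_sum A C \<in> subspaces K V" by (rule subspace_sum_in_subspaces[OF A C'(1)])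
  have "B \<subseteq> subspace_sum A C"
  proof (rule ccontr)
    assume "\<not> B \<subseteq> subspace_sum A C"
    then obtain x where x: "x \<in> B" "x \<notin> subspace_sum A C" by auto
    have xV: "x \<in> carrier V" using x BD by auto
    let ?C = "subspace_sum C (line x)"
    have Cx: "?C \<in> subspaces K V"
      by (rule subspace_sum_in_subspaces[OF C'(1) line_in_subspaces[OF xV]])
    have "line x \<subseteq> B" using x BD by (auto simp: line_def)
    then have CB: "?C \<subseteq> B" using C' B by (intro subspace_sum_least)
    have "y = \<zero>\<^bsub>V\<^esub>" if y: "y \<in> A" "y \<in> ?C" for y
    proof -
      obtain u c where u: "u \<in> C" and c: "c \<in> carrier K" and yu: "y = u \<oplus>\<^bsub>V\<^esub> c \<odot>\<^bsub>V\<^esub> x"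
        using y by (auto simp: subspace_sum_eq line_def)
      have uV: "u \<in> carrier V" and yV: "y \<in> carrier V" using u y CD AD by auto
      show "y = \<zero>\<^bsub>V\<^esub>"
      proof (cases "c = \<zero>\<^bsub>K\<^esub>")
        case True
        then have "y = u" using yu uV xV by simp
        then show ?thesis using y u C'(3) by auto
      next
        case False
        \<comment> \<open>With y = u + c x and c invertible, x is a multiple of y - u, which lies in
          \<open>A + C\<close>; this contradicts the choice of x.\<close>
        then have cinv: "inv\<^bsub>K\<^esub> c \<in> carrier K" "inv\<^bsub>K\<^esub> c \<otimes>\<^bsub>K\<^esub> c = \<one>\<^bsub>K\<^esub>"
          using c by (auto simp: field_Units)
        have "c \<odot>\<^bsub>V\<^esub> x = y \<oplus>\<^bsub>V\<^esub> \<ominus>\<^bsub>V\<^esub> u"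
          using yu uV xV c by (simp add: M.a_ac M.r_neg1 M.r_neg2)
        also have "\<dots> \<in> subspace_sum A C"
          using y(1) u CD(7) by (auto simp: subspace_sum_eq)
        finally have "inv\<^bsub>K\<^esub> c \<odot>\<^bsub>V\<^esub> (c \<odot>\<^bsub>V\<^esub> x) \<in> subspace_sum A C"
          using subspacesD(4)[OF AC cinv(1)] by simp
        then have "x \<in> subspace_sum A C"
          using cinv c xV by (simp flip: smult_assoc1)
        then show ?thesis using x by simp
      qed
    qed
    then have "A \<inter> ?C = {\<zero>\<^bsub>V\<^esub>}" using AD(2) subspacesD(2)[OF Cx] by blast
    then have "?C \<in> ?S" using Cx CB by simp
    then have "?C = C"
      by (rule max) (rule subspace_sum_upper(1)[OF C'(1) line_in_subspaces[OF xV]])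
    then have "x \<in> C"
      using mem_line[OF xV] subspace_sum_upper(2)[OF C'(1) line_in_subspaces[OF xV]] by auto
    then show False using x(2) subspace_sum_upper(2)[OF A C'(1)] by auto
  qed
  moreover have "subspace_sum A C \<subseteq> B" by (rule subspace_sum_least[OF AB C'(2) B])
  ultimately show thesis using C' that by blast
qed

text \<open>With a complement \<open>C\<close> of \<open>B\<close>, addition identifies the direct
  sum of \<open>B\<close> and \<open>C\<close> with \<open>V\<close>; the extension is
  \<open>f\<close> after projection to \<open>B\<close>. This is how complements enter the splitting
  of a chain.\<close>

lemma linear_map_extend:
  assumes B: "B \<in> subspaces K V" and f: "linear_map K (V\<lparr>carrier := B\<rparr>) W f"
  obtains g where "linear_map K V W g" "\<And>x. x \<in> B \<Longrightarrow> g x = f x"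
proof -
  note BD = subspacesD[OF B]
  obtain C where C: "C \<in> subspaces K V" and int: "B \<inter> C = {\<zero>\<^bsub>V\<^esub>}" and sum: "subspace_sum B C = carrier V"
    by (rule complement_exists[OF B carrier_in_subspaces BD(1)])
  note CD = subspacesD[OF C]
  let ?D = "direct_sum (V\<lparr>carrier := B\<rparr>) (V\<lparr>carrier := C\<rparr>)"
  define s where "s = (\<lambda>p. fst p \<oplus>\<^bsub>V\<^esub> snd p)"
  have s: "linear_map K ?D V s"
    unfolding s_def using B C by (intro sum_map_linear) (simp_all add: subspaces_def)
  have "bij_betw s (carrier ?D) (carrier V)"
    unfolding bij_betw_def
  proof
    show "inj_on s (carrier ?D)"
    proof (rule linear_map.Ke0_imp_inj[OF s])
      have "p = (\<zero>\<^bsub>V\<^esub>, \<zero>\<^bsub>V\<^esub>)" if p: "fst p \<in> B" "snd p \<in> C" "s p = \<zero>\<^bsub>V\<^esub>" for p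
      proof -
        have "snd p = \<ominus>\<^bsub>V\<^esub> fst p"
          using p BD CD unfolding s_def by (metis M.minus_equality M.a_comm)
        then have "snd p \<in> B \<inter> C" using p BD(7) by auto
        then have 2: "snd p = \<zero>\<^bsub>V\<^esub>" using int by auto
        then have "fst p = \<zero>\<^bsub>V\<^esub>" using p BD by (auto simp: s_def)
        then show ?thesis using 2 by (metis prod.collapse)
      qed
      then show "carrier (?D\<lparr>carrier := mod_hom.ker ?D V s\<rparr>) = {\<zero>\<^bsub>?D\<^esub>}"
        unfolding mod_hom.ker_def[OF linear_map.axioms(3)[OF s]]
        using BD(2) CD(2) by (auto simp: s_def)
    qed
    show "s ` carrier ?D = carrier V"
      unfolding sum[symmetric] by (auto simp: s_def subspace_sum_eq image_iff; blast)
  qed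
  note bij = this
  let ?i = "inv_into (carrier ?D) s"
  have vB: "vectorspace K (V\<lparr>carrier := B\<rparr>)" and vC: "vectorspace K (V\<lparr>carrier := C\<rparr>)"
    using B C subspace_is_vectorspace by auto
  have "linear_map K V W (\<lambda>x. f (fst (?i x)))"
    by (rule linear_map_comp[OF linear_map_comp[OF linear_map_inv_into[OF s bij]
          linear_map_fst[OF vB vC]] f])
  moreover have "f (fst (?i x)) = f x" if x: "x \<in> B" for x
  proof -
    have "s (x, \<zero>\<^bsub>V\<^esub>) = x" using x BD by (auto simp: s_def)
    then have "?i x = (x, \<zero>\<^bsub>V\<^esub>)"
      using inv_into_f_f[OF bij_betw_imp_inj_on[OF bij], of "(x, \<zero>\<^bsub>V\<^esub>)"] x CD by simp
    then show ?thesis by simp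
  qed
  ultimately show thesis by (rule that)
qed

end

section \<open>\<open>q\<close>-matroids and the rank function of the free product\<close>

text \<open>Over finite scalars, finite dimension amounts to a finite ground space, and the locale
  asks for the latter. Keeping the rank function apart from the space lets explicit formulas such as
  \<open>fp_rank\<close> be used as rank functions directly.\<close>

locale finite_q_matroid = finite_vectorspace K V for K and V +
  fixes r :: "'c set \<Rightarrow> int"
  assumes rank_nonneg: "A \<in> subspaces K V \<Longrightarrow> 0 \<le> r A"
    and rank_le_sdim: "A \<in> subspaces K V \<Longrightarrow> r A \<le> sdim K V A"
    and rank_mono: "A \<in> subspaces K V \<Longrightarrow> B \<in> subspaces K V \<Longrightarrow> A \<subseteq> B \<Longrightarrow> r A \<le> r B"
    and rank_submodular: "A \<in> subspaces K V \<Longrightarrow> B \<in> subspaces K V \<Longrightarrow>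
      r (subspace_sum A B) + r (A \<inter> B) \<le> r A + r B"

lemma finite_carrier_of_fin_dim:
  assumes "vectorspace K V" "vectorspace.fin_dim K V" "finite (carrier K)"
  shows "finite (carrier V)"
proof -
  interpret vectorspace K V by fact
  obtain B where B: "finite B" "basis B" using finite_basis_exists[OF assms(2)] by auto
  then have BV: "B \<subseteq> carrier V" by (simp add: basis_def)
  have "carrier V \<subseteq> (\<lambda>a. lincomb a B) ` (B \<rightarrow>\<^sub>E carrier K)"
  proof
    fix v assume "v \<in> carrier V"
    then obtain a where "a \<in> B \<rightarrow>\<^sub>E carrier K" "lincomb a B = v"
      using basis_criterion[OF B(1) BV] B(2) by blast
    then show "v \<in> (\<lambda>a. lincomb a B) ` (B \<rightarrow>\<^sub>E carrier K)" by blast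
  qed
  then show ?thesis
    using finite_PiE[OF B(1), of "\<lambda>_. carrier K"] assms(3) finite_subset by blast
qed

lemma q_matroid_iff:
  assumes "finite (carrier K)"
  shows "q_matroid K M \<longleftrightarrow> finite_q_matroid K (space M) (rk M)"
proof
  assume M: "q_matroid K M"
  then have "vectorspace K (space M)" "vectorspace.fin_dim K (space M)"
    by (auto simp: q_matroid_def)
  then have "finite_vectorspace K (space M)"
    using finite_carrier_of_fin_dim assms
    by (simp add: finite_vectorspace_def plain_vectorspace_iff finite_vectorspace_axioms_def)
  then show "finite_q_matroid K (space M) (rk M)"
    using M by (simp add: finite_q_matroid_def finite_q_matroid_axioms_def q_matroid_def)
next
  assume "finite_q_matroid K (space M) (rk M)"
  then interpret finite_q_matroid K "space M" "rk M" .
  show "q_matroid K M"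
    unfolding q_matroid_def
    using vectorspace_axioms fin_dim rank_nonneg rank_le_sdim rank_mono rank_submodular by blast
qed

section \<open>Rank and independence within one q-matroid\<close>

context finite_q_matroid
begin

lemma rank_zero: "r {\<zero>\<^bsub>V\<^esub>} = 0"
  using rank_nonneg[OF zero_in_subspaces] rank_le_sdim[OF zero_in_subspaces] sdim_zero by linarith

text \<open>Submodularity for \<open>A\<close> and a complement of \<open>A\<close> in
  \<open>B\<close>: the two meet in zero, and the rank of the complement is at most its
  dimension.\<close>

lemma rank_increment_le:
  assumes A: "A \<in> subspaces K V" and B: "B \<in> subspaces K V" and AB: "A \<subseteq> B"
  shows "r B - r A \<le> sdim K V B - sdim K V A"
proof -
  obtain C where C: "C \<in> subspaces K V" "A \<inter> C = {\<zero>\<^bsub>V\<^esub>}" "subspace_sum A C = B"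
    by (rule complement_exists[OF A B AB])
  show ?thesis
    using rank_submodular[OF A C(1)] rank_le_sdim[OF C(1)] sdim_subspace_sum[OF A C(1)]
      rank_zero sdim_zero C(2,3) by simp
qed

lemma independentI:
  assumes "A \<in> subspaces K V" "sdim K V A \<le> r A"
  shows "independent K (V, r) A"
  using assms rank_le_sdim[OF assms(1)] by (simp add: independent_def)

text \<open>Take \<open>I\<close> maximal among the independent spaces in \<open>X\<close>.
  Adjoining any single line of \<open>X\<close> leaves the rank unchanged, and submodularity
  accumulates this over all vectors of \<open>X\<close>: a maximal \<open>J\<close> between
  \<open>I\<close> and \<open>X\<close> with the rank of \<open>I\<close> must be
  \<open>X\<close>.\<close>

lemma independent_spanning_exists:
  assumes X: "X \<in> subspaces K V"
  obtains I where "I \<subseteq> X" "independent K (V, r) I" "r I = r X"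
proof -
  let ?S = "{I. I \<subseteq> X \<and> independent K (V, r) I}"
  have "?S \<subseteq> subspaces K V" by (auto simp: independent_def)
  then have finS: "finite ?S" using finite_subspaces finite_subset by blast
  have "{\<zero>\<^bsub>V\<^esub>} \<in> ?S"
    using subspacesD(2)[OF X] rank_zero sdim_zero zero_in_subspaces by (simp add: independent_def)
  then obtain I where IS: "I \<in> ?S" and Imax: "\<And>J. J \<in> ?S \<Longrightarrow> I \<subseteq> J \<Longrightarrow> J = I"
    using finite_has_maximal[OF finS] by (metis (no_types, lifting) empty_iff)
  then have I: "I \<in> subspaces K V" "I \<subseteq> X" "r I = sdim K V I" by (auto simp: independent_def)
  have line: "r (subspace_sum I (line x)) = r I" if x: "x \<in> X" for x
  proof (cases "x \<in> I")
    have xV: "x \<in> carrier V" using x subspacesD(6)[OF X] by blast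
    note L = line_in_subspaces[OF xV]
    have IL: "subspace_sum I (line x) \<in> subspaces K V"
      by (rule subspace_sum_in_subspaces[OF I(1) L])
    have le: "r I \<le> r (subspace_sum I (line x))"
      by (rule rank_mono[OF I(1) IL subspace_sum_upper(1)[OF I(1) L]])
    case False
    have "\<not> independent K (V, r) (subspace_sum I (line x))"
    proof
      assume "independent K (V, r) (subspace_sum I (line x))"
      moreover have "line x \<subseteq> X" using x subspacesD(4)[OF X] by (auto simp: line_def)
      then have "subspace_sum I (line x) \<subseteq> X" by (rule subspace_sum_least[OF I(2) _ X])
      ultimately have "subspace_sum I (line x) = I"
        using subspace_sum_upper(1)[OF I(1) L] by (intro Imax) simp_all
      then show False
        using False mem_line[OF xV] subspace_sum_upper(2)[OF I(1) L] by auto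
    qed
    \<comment> \<open>The enlarged space is dependent by maximality, so its rank is below its
      dimension, which is at most one more than the dimension of \<open>I\<close>, that is, the rank
      of \<open>I\<close>.\<close>
    then have "r (subspace_sum I (line x)) < sdim K V (subspace_sum I (line x))"
      using independentI[OF IL] by linarith
    also have "\<dots> \<le> sdim K V I + 1"
      using sdim_subspace_sum[OF I(1) L] sdim_line_le[OF xV] sdim_nonneg[of K V "I \<inter> line x"] by linarith
    finally show ?thesis using I(3) le by linarith
  next
    case True
    have xV: "x \<in> carrier V" using x subspacesD(6)[OF X] by blast
    have "line x \<subseteq> I" using True subspacesD(4)[OF I(1)] by (auto simp: line_def)
    then have "subspace_sum I (line x) = I"
      using subspace_sum_least[OF _ _ I(1)] subspace_sum_upper(1)[OF I(1) line_in_subspaces[OF xV]]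
      by (simp add: subset_antisym)
    then show ?thesis by simp
  qed
  let ?T = "{J \<in> subspaces K V. I \<subseteq> J \<and> J \<subseteq> X \<and> r J = r I}"
  have finT: "finite ?T" using finite_subspaces by simp
  have "I \<in> ?T" using I by simp
  then obtain J where JT: "J \<in> ?T" and Jmax: "\<And>J'. J' \<in> ?T \<Longrightarrow> J \<subseteq> J' \<Longrightarrow> J' = J"
    using finite_has_maximal[OF finT] by (metis (no_types, lifting) empty_iff)
  then have J: "J \<in> subspaces K V" "I \<subseteq> J" "J \<subseteq> X" "r J = r I" by auto
  have "X \<subseteq> J"
  proof
    fix x assume x: "x \<in> X"
    have xV: "x \<in> carrier V" using x subspacesD(6)[OF X] by blast
    note L = line_in_subspaces[OF xV]
    have IL: "subspace_sum I (line x) \<in> subspaces K V"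
      by (rule subspace_sum_in_subspaces[OF I(1) L])
    have JL: "subspace_sum J (line x) \<in> subspaces K V"
      by (rule subspace_sum_in_subspaces[OF J(1) L])
    let ?J = "subspace_sum J (subspace_sum I (line x))"
    have J': "?J \<in> subspaces K V" by (rule subspace_sum_in_subspaces[OF J(1) IL])
    have Jup: "J \<subseteq> ?J" "subspace_sum I (line x) \<subseteq> ?J"
      using subspace_sum_upper[OF J(1) IL] by auto
    \<comment> \<open>\<open>J\<close> and \<open>I + line x\<close> both have the rank of
      \<open>I\<close>, and so has at least their intersection, which contains \<open>I\<close>.
      Submodularity then bounds the rank of their sum by that of \<open>J\<close>.\<close>
    have "r I \<le> r (J \<inter> subspace_sum I (line x))"
      using J subspace_sum_upper(1)[OF I(1) L] by (intro rank_mono Int_in_subspaces I IL) auto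
    then have "r ?J \<le> r J"
      using rank_submodular[OF J(1) IL] line[OF x] by linarith
    moreover have "r J \<le> r ?J" by (rule rank_mono[OF J(1) J' Jup(1)])
    moreover have "line x \<subseteq> X" using x subspacesD(4)[OF X] by (auto simp: line_def)
    then have "?J \<subseteq> X" by (intro subspace_sum_least J(3) I(2) X)
    ultimately have "?J \<in> ?T" using J' J Jup by auto
    then have "?J = J" using Jup(1) by (rule Jmax)
    then show "x \<in> J"
      using mem_line[OF xV] subspace_sum_upper(2)[OF I(1) L] Jup(2) by auto
  qed
  then have "r I = r X" using J by auto
  then show thesis using IS that by auto
qed

end

text \<open>The rank of \<open>X\<close> under \<open>r\<close> is the dimension of some independent
  space inside \<open>X\<close>, which is also independent under \<open>s\<close>. Used in both
  directions, this shows that the independent spaces determine the rank.\<close>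

lemma rank_le_if_independent_imp:
  assumes r: "finite_q_matroid K V r" and s: "finite_q_matroid K V s"
    and imp: "\<And>I. I \<in> subspaces K V \<Longrightarrow> independent K (V, r) I \<Longrightarrow> independent K (V, s) I"
    and X: "X \<in> subspaces K V"
  shows "r X \<le> s X"
proof -
  interpret r: finite_q_matroid K V r by fact
  interpret s: finite_q_matroid K V s by fact
  obtain I where I: "I \<subseteq> X" "independent K (V, r) I" "r I = r X"
    by (rule r.independent_spanning_exists[OF X])
  then have IV: "I \<in> subspaces K V" by (simp add: independent_def)
  have "r I = s I" using I(2) imp[OF IV I(2)] by (simp add: independent_def)
  also have "\<dots> \<le> s X" by (rule s.rank_mono[OF IV X I(1)])
  finally show ?thesis using I(3) by simp
qed

section \<open>The rank function of a free product of two factors\<close>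

definition fp_rank ::
  "('k, 'x) ring_scheme \<Rightarrow> ('k, 'v) qmat \<Rightarrow> ('k, 'w) qmat \<Rightarrow> ('v \<times> 'w) set \<Rightarrow> int" where
  "fp_rank K M1 M2 X =
     min (rk M1 (carrier (space M1)) + rk M2 (snd ` X))
         (rk M1 (left_part (space M1) (space M2) X) + sdim K (space M2) (snd ` X))"

text \<open>Submodularity is a case distinction on which term attains the minimum at
  \<open>X\<close> and at \<open>Y\<close>. If the same term does, it is used for both the sum and
  the intersection; in the mixed cases the first term bounds the sum and the second term the
  intersection.\<close>

lemma finite_q_matroid_fp_rank:
  assumes M1: "finite_q_matroid K (space M1) (rk M1)" and M2: "finite_q_matroid K (space M2) (rk M2)"
  shows "finite_q_matroid K (direct_sum (space M1) (space M2)) (fp_rank K M1 M2)"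
proof -
  let ?D = "direct_sum (space M1) (space M2)"
  interpret M1: finite_q_matroid K "space M1" "rk M1" by fact
  interpret M2: finite_q_matroid K "space M2" "rk M2" by fact
  note fv = M1.finite_vectorspace_axioms M2.finite_vectorspace_axioms
  note vs = M1.vectorspace_axioms M2.vectorspace_axioms
  interpret D: finite_vectorspace K ?D by (rule finite_vectorspace_direct_sum[OF fv])
  let ?l = "left_part (space M1) (space M2)"
  have l: "?l X \<in> subspaces K (space M1)" if "X \<in> subspaces K ?D" for X
    by (rule left_part_in_subspaces[OF vs that])
  have p: "snd ` X \<in> subspaces K (space M2)" if "X \<in> subspaces K ?D" for X
    by (rule image_in_subspaces[OF linear_map_snd[OF vs] that])
  have dim: "sdim K ?D X = sdim K (space M1) (?l X) + sdim K (space M2) (snd ` X)"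
    if "X \<in> subspaces K ?D" for X
    by (rule sdim_direct_sum[OF fv that])
  note E1 = M1.carrier_in_subspaces
  show ?thesis
  proof
    fix X assume X: "X \<in> subspaces K ?D"
    show "0 \<le> fp_rank K M1 M2 X"
      using M1.rank_nonneg[OF l[OF X]] M1.rank_nonneg[OF E1] M2.rank_nonneg[OF p[OF X]]
      by (simp add: fp_rank_def)
    show "fp_rank K M1 M2 X \<le> sdim K ?D X"
      using M1.rank_le_sdim[OF l[OF X]] dim[OF X] by (simp add: fp_rank_def)
  next
    fix X Y assume X: "X \<in> subspaces K ?D" and Y: "Y \<in> subspaces K ?D" and XY: "X \<subseteq> Y"
    have "?l X \<subseteq> ?l Y" "snd ` X \<subseteq> snd ` Y" using XY by (auto simp: mem_left_part_iff)
    then show "fp_rank K M1 M2 X \<le> fp_rank K M1 M2 Y"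
      using M1.rank_mono[OF l[OF X] l[OF Y]] M2.rank_mono[OF p[OF X] p[OF Y]]
        M2.sdim_mono[OF p[OF X] p[OF Y]]
      unfolding fp_rank_def by linarith
  next
    fix X Y assume X: "X \<in> subspaces K ?D" and Y: "Y \<in> subspaces K ?D"
    let ?U = "D.subspace_sum X Y" and ?I = "X \<inter> Y"
    have U: "?U \<in> subspaces K ?D" by (rule D.subspace_sum_in_subspaces[OF X Y])
    have I: "?I \<in> subspaces K ?D" by (rule D.Int_in_subspaces[OF X Y])
    have sndU: "snd ` ?U = M2.subspace_sum (snd ` X) (snd ` Y)"
      unfolding D.subspace_sum_eq M2.subspace_sum_eq
      by (auto simp: direct_sum_def image_iff; force)
    have lI: "?l ?I = ?l X \<inter> ?l Y" by (auto simp: mem_left_part_iff)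
    have lX: "?l X \<subseteq> ?l ?U" "?l Y \<subseteq> ?l ?U"
      using D.subspace_sum_upper[OF X Y] by (auto simp: mem_left_part_iff)
    let ?S = "M1.subspace_sum (?l X) (?l Y)"
    have S: "?S \<in> subspaces K (space M1)" by (rule M1.subspace_sum_in_subspaces[OF l[OF X] l[OF Y]])
    have SU: "?S \<subseteq> ?l ?U" by (rule M1.subspace_sum_least[OF lX l[OF U]])
    let ?P = "snd ` X \<inter> snd ` Y"
    have P: "?P \<in> subspaces K (space M2)" by (rule M2.Int_in_subspaces[OF p[OF X] p[OF Y]])
    have IP: "snd ` ?I \<subseteq> ?P" by auto
    \<comment> \<open>The left part of the sum may exceed the sum of the left parts, and the
      projection of the intersection may be smaller than the intersection of the projections; these
      two defects in dimension are equal. \<open>rank_increment_le\<close> for \<open>M1\<close>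
      pays for the first when the second term is used throughout; for \<open>M2\<close>, once for
      \<open>X\<close> and once for \<open>Y\<close>, it serves the two mixed cases.\<close>
    note facts =
      dim[OF X] dim[OF Y] dim[OF U] dim[OF I] D.sdim_subspace_sum[OF X Y]
      M1.sdim_subspace_sum[OF l[OF X] l[OF Y]] M2.sdim_mono[OF p[OF I] P IP]
      M1.rank_submodular[OF l[OF X] l[OF Y]] M2.rank_submodular[OF p[OF X] p[OF Y]]
      M1.rank_increment_le[OF S l[OF U] SU] M2.rank_mono[OF p[OF I] P IP]
      M2.rank_increment_le[OF P p[OF X] Int_lower1] M2.rank_increment_le[OF P p[OF Y] Int_lower2]
      M1.rank_mono[OF l[OF I] l[OF X]] M1.rank_mono[OF l[OF I] l[OF Y]]
    show "fp_rank K M1 M2 ?U + fp_rank K M1 M2 ?I \<le> fp_rank K M1 M2 X + fp_rank K M1 M2 Y"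
      using facts unfolding fp_rank_def sndU lI by (simp add: min_def)
  qed
qed

text \<open>Independence means that both terms reach dim J + dim (\<pi>2 I). For the second term
  this says that J is independent in \<open>M1\<close>; given that, for the first term it is exactly
  the inequality between \<open>rank_lack\<close> and \<open>nullity\<close>.\<close>

lemma independent_fp_rank_iff:
  assumes M1: "finite_q_matroid K (space M1) (rk M1)" and M2: "finite_q_matroid K (space M2) (rk M2)"
    and I: "I \<in> subspaces K (direct_sum (space M1) (space M2))"
  shows "independent K (direct_sum (space M1) (space M2), fp_rank K M1 M2) I \<longleftrightarrow> fp_indep K M1 M2 I"
proof -
  interpret M1: finite_q_matroid K "space M1" "rk M1" by fact
  interpret M2: finite_q_matroid K "space M2" "rk M2" by fact
  let ?J = "left_part (space M1) (space M2) I"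
  have J: "?J \<in> subspaces K (space M1)"
    by (rule left_part_in_subspaces[OF M1.vectorspace_axioms M2.vectorspace_axioms I])
  note dim = sdim_direct_sum[OF M1.finite_vectorspace_axioms M2.finite_vectorspace_axioms I]
  show ?thesis
    using M1.rank_le_sdim[OF J] I J dim
    unfolding independent_def fp_indep_def Let_def left_part_def[symmetric] rank_lack_def nullity_def
      fp_rank_def
    by auto
qed

lemma space_free_product: "space (free_product K M1 M2) = direct_sum (space M1) (space M2)"
  by (simp add: free_product_def Let_def)

text \<open>\<open>fp_rank\<close> witnesses that the choice in \<open>free_product\<close> can be
  made. The chosen function has the same independent spaces and hence the same values on
  subspaces.\<close>

lemma free_product_rank:
  assumes K: "finite (carrier K)" and M1: "q_matroid K M1" and M2: "q_matroid K M2"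
  shows "q_matroid K (free_product K M1 M2)"
    and "X \<in> subspaces K (direct_sum (space M1) (space M2)) \<Longrightarrow>
      rk (free_product K M1 M2) X = fp_rank K M1 M2 X"
proof -
  let ?D = "direct_sum (space M1) (space M2)" and ?M = "free_product K M1 M2"
  note M12 = M1[unfolded q_matroid_iff[OF K]] M2[unfolded q_matroid_iff[OF K]]
  let ?P = "\<lambda>r. q_matroid K (?D, r) \<and>
    (\<forall>I \<in> subspaces K ?D. independent K (?D, r) I \<longleftrightarrow> fp_indep K M1 M2 I)"
  have fp: "?P (fp_rank K M1 M2)"
    using finite_q_matroid_fp_rank[OF M12] independent_fp_rank_iff[OF M12]
    by (simp add: q_matroid_iff[OF K])
  have "?P (rk ?M)"
    using someI[of ?P, OF fp] by (simp add: free_product_def Let_def)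
  then have M: "?P (rk ?M)" by blast
  then show "q_matroid K ?M"
    by (metis space_free_product prod.collapse)
  show "X \<in> subspaces K ?D \<Longrightarrow> rk ?M X = fp_rank K M1 M2 X"
    using M fp unfolding q_matroid_iff[OF K] fst_conv snd_conv
    by (intro antisym rank_le_if_independent_imp[of K ?D]) blast+
qed

section \<open>Carrying q-matroids along linear bijections\<close>

lemma image_vimage_bij:
  assumes "bij_betw f (carrier V) (carrier W)" "A \<subseteq> carrier W"
  shows "f ` {x \<in> carrier V. f x \<in> A} = A"
  using assms by (force simp: bij_betw_def)

lemma image_subspace_sum:
  assumes f: "linear_map K V W f" and A: "A \<in> subspaces K V" and B: "B \<in> subspaces K V"
  shows "f ` module.submodule_sum V A B = module.submodule_sum W (f ` A) (f ` B)"
proof -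
  interpret V: plain_vectorspace K V unfolding plain_vectorspace_iff using f by (rule linear_mapD)
  interpret W: vectorspace K W using f by (rule linear_mapD)
  have "f (x \<oplus>\<^bsub>V\<^esub> y) = f x \<oplus>\<^bsub>W\<^esub> f y" if "x \<in> A" "y \<in> B" for x y
    using that linear_mapD(4)[OF f] V.subspacesD(6)[OF A] V.subspacesD(6)[OF B] by blast
  then show ?thesis
    unfolding V.submodule_sum_def W.submodule_sum_def by (force simp: image_iff)
qed

lemma finite_q_matroid_image:
  assumes V: "finite_q_matroid K V r" and f: "linear_map K V W f"
    and bij: "bij_betw f (carrier V) (carrier W)"
    and s: "\<And>X. X \<in> subspaces K V \<Longrightarrow> s (f ` X) = r X"
  shows "finite_q_matroid K W s"
proof -
  interpret V: finite_q_matroid K V r by fact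
  have "finite_vectorspace K W"
    using linear_mapD(2)[OF f] V.finite_scalars V.finite_carrier bij_betw_finite[OF bij]
    by (simp add: finite_vectorspace_def plain_vectorspace_iff finite_vectorspace_axioms_def)
  then interpret W: finite_vectorspace K W .
  have inj: "inj_on f (carrier V)" using bij by (rule bij_betw_imp_inj_on)
  have ex: "\<exists>X \<in> subspaces K V. A = f ` X" if "A \<in> subspaces K W" for A
    using image_vimage_bij[OF bij W.subspacesD(1)[OF that]] vimage_in_subspaces[OF f that] by metis
  have dim: "sdim K W (f ` X) = sdim K V X" if "X \<in> subspaces K V" for X
    by (rule V.sdim_inj_image[OF f that inj_on_subset[OF inj V.subspacesD(1)[OF that]]])
  have Int: "f ` X \<inter> f ` Y = f ` (X \<inter> Y)" if "X \<in> subspaces K V" "Y \<in> subspaces K V" for X Y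
    using inj_on_image_Int[OF inj] V.subspacesD(1) that by metis
  show ?thesis
  proof
    fix A assume "A \<in> subspaces K W"
    then obtain X where X: "X \<in> subspaces K V" "A = f ` X" using ex by blast
    show "0 \<le> s A" "s A \<le> sdim K W A"
      using X V.rank_nonneg V.rank_le_sdim by (simp_all add: s dim)
    fix B assume "B \<in> subspaces K W"
    then obtain Y where Y: "Y \<in> subspaces K V" "B = f ` Y" using ex by blast
    show "s (W.subspace_sum A B) + s (A \<inter> B) \<le> s A + s B"
      using X Y V.rank_submodular[OF X(1) Y(1)] V.Int_in_subspaces V.subspace_sum_in_subspaces
      by (simp add: s Int image_subspace_sum[OF f, symmetric])
    show "s A \<le> s B" if "A \<subseteq> B"
    proof -
      have "X \<subseteq> Y"
      proof
        fix x assume x: "x \<in> X"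
        then have "f x \<in> f ` Y" using that X(2) Y(2) by blast
        then show "x \<in> Y"
          using inj_on_image_mem_iff[OF inj V.subspacesD(6)[OF X(1) x] V.subspacesD(1)[OF Y(1)]] by simp
      qed
      then show ?thesis using X Y V.rank_mono by (simp add: s)
    qed
  qed
qed

lemma transport_iso:
  assumes inj: "inj f" and M: "vectorspace K (space M)"
  shows "linear_map K (space M) (space (transport f M)) f"
    and "bij_betw f (carrier (space M)) (carrier (space (transport f M)))"
    and "rk (transport f M) (f ` X) = rk M X"
proof -
  interpret M: vectorspace K "space M" by fact
  let ?g = "inv_into UNIV f" and ?T = "space (transport f M)"
  have gf [simp]: "?g (f x) = x" for x using inj by simp
  show bij: "bij_betw f (carrier (space M)) (carrier ?T)"
    using inj by (auto simp: transport_def Let_def bij_betw_def inj_on_def)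
  have "bij_betw ?g (carrier ?T) (carrier (space M))"
    by (rule bij_betw_byWitness[where f' = f]) (auto simp: transport_def Let_def)
  then have "linear_map K ?T (space M) ?g"
    by (rule vectorspace_pullback[OF M]) (auto simp: transport_def Let_def)
  then have "vectorspace K ?T" by (rule linear_mapD)
  then show "linear_map K (space M) ?T f"
    by (rule linear_mapI[OF M]) (auto simp: transport_def Let_def)
  have "?g ` f ` X = X" by (simp add: image_image)
  then show "rk (transport f M) (f ` X) = rk M X"
    by (simp add: transport_def Let_def)
qed

section \<open>Minors as linear surjections\<close>

lemma linear_map_codomain:
  assumes f: "linear_map K V W f" and B: "B \<in> subspaces K W"
    and fB: "\<And>x. x \<in> carrier V \<Longrightarrow> f x \<in> B"
  shows "linear_map K V (W\<lparr>carrier := B\<rparr>) f"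
proof -
  interpret W: plain_vectorspace K W unfolding plain_vectorspace_iff using f by (rule linear_mapD)
  show ?thesis
    by (rule linear_mapI) (use linear_mapD[OF f] fB W.subspace_is_vectorspace[OF B] in auto)
qed

lemma quotient_space_simps [simp]:
  "\<zero>\<^bsub>quotient_space V A\<^esub> = A"
  "X \<oplus>\<^bsub>quotient_space V A\<^esub> Y = X <+>\<^bsub>V\<^esub> Y"
  "c \<odot>\<^bsub>quotient_space V A\<^esub> X = (\<Union>x\<in>X. A +>\<^bsub>V\<^esub> (c \<odot>\<^bsub>V\<^esub> x))"
  "carrier (quotient_space V A) = (\<lambda>x. A +>\<^bsub>V\<^esub> x) ` carrier V"
  by (auto simp: quotient_space_def A_RCOSETS_def')

section \<open>Cosets and the first isomorphism theorem\<close>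

context plain_vectorspace
begin

lemma subspace_abelian_subgroup:
  assumes A: "A \<in> subspaces K V"
  shows "abelian_subgroup A V"
proof (rule abelian_subgroupI3)
  show "additive_subgroup A V"
  proof (unfold additive_subgroup_def, rule add.subgroupI)
    show "A \<noteq> {}" using subspacesD(2)[OF A] by auto
  qed (use subspacesD[OF A] in auto)
  show "abelian_group V" ..
qed

lemma coset_eq_iff:
  assumes A: "A \<in> subspaces K V" and x: "x \<in> carrier V" and y: "y \<in> carrier V"
  shows "A +>\<^bsub>V\<^esub> x = A +>\<^bsub>V\<^esub> y \<longleftrightarrow> x \<ominus>\<^bsub>V\<^esub> y \<in> A"
proof -
  interpret A: abelian_subgroup A V by (rule subspace_abelian_subgroup[OF A])
  have "A +>\<^bsub>V\<^esub> x = A +>\<^bsub>V\<^esub> y \<longleftrightarrow> x \<in> A +>\<^bsub>V\<^esub> y"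
    using A.a_repr_independence'[OF _ y] A.a_rcos_self[OF x] by metis
  then show ?thesis by (simp add: A.a_rcos_module[OF y x] a_minus_def)
qed

text \<open>The union in \<open>quotient_space\<close> runs over all representatives u of the coset
  of x, and each contributes the same coset, since c u - c x is c times an element of
  \<open>A\<close>.\<close>

lemma coset_smult:
  assumes A: "A \<in> subspaces K V" and c: "c \<in> carrier K" and x: "x \<in> carrier V"
  shows "(\<Union>u \<in> A +>\<^bsub>V\<^esub> x. A +>\<^bsub>V\<^esub> (c \<odot>\<^bsub>V\<^esub> u)) = A +>\<^bsub>V\<^esub> (c \<odot>\<^bsub>V\<^esub> x)"
proof -
  interpret A: abelian_subgroup A V by (rule subspace_abelian_subgroup[OF A])
  have "A +>\<^bsub>V\<^esub> (c \<odot>\<^bsub>V\<^esub> u) = A +>\<^bsub>V\<^esub> (c \<odot>\<^bsub>V\<^esub> x)" if u: "u \<in> A +>\<^bsub>V\<^esub> x" for u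
  proof -
    obtain a where a: "a \<in> A" "u = a \<oplus>\<^bsub>V\<^esub> x" using u by (auto simp: a_r_coset_def')
    have aV: "a \<in> carrier V" using subspacesD(6)[OF A a(1)] .
    have "c \<odot>\<^bsub>V\<^esub> u \<ominus>\<^bsub>V\<^esub> c \<odot>\<^bsub>V\<^esub> x = c \<odot>\<^bsub>V\<^esub> a"
      using aV x c by (simp add: a smult_r_distr a_minus_def M.a_assoc M.r_neg)
    then show ?thesis
      using coset_eq_iff[OF A, of "c \<odot>\<^bsub>V\<^esub> u" "c \<odot>\<^bsub>V\<^esub> x"] subspacesD(4)[OF A c a(1)] aV x c a
      by simp
  qed
  moreover have "x \<in> A +>\<^bsub>V\<^esub> x" by (rule A.a_rcos_self[OF x])
  ultimately show ?thesis by blast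
qed

lemma coset_add:
  assumes A: "A \<in> subspaces K V" and "x \<in> carrier V" "y \<in> carrier V"
  shows "(A +>\<^bsub>V\<^esub> x) <+>\<^bsub>V\<^esub> (A +>\<^bsub>V\<^esub> y) = A +>\<^bsub>V\<^esub> (x \<oplus>\<^bsub>V\<^esub> y)"
  using abelian_subgroup.a_rcos_sum[OF subspace_abelian_subgroup[OF A]] assms by simp

lemma coset_eq_self_iff:
  assumes A: "A \<in> subspaces K V" and x: "x \<in> carrier V"
  shows "A +>\<^bsub>V\<^esub> x = A \<longleftrightarrow> x \<in> A"
proof -
  have "A = A +>\<^bsub>V\<^esub> \<zero>\<^bsub>V\<^esub>"
    using abelian_subgroup.a_rcos_const[OF subspace_abelian_subgroup[OF A] subspacesD(2)[OF A]] by simp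
  moreover have "x \<ominus>\<^bsub>V\<^esub> \<zero>\<^bsub>V\<^esub> = x" using x by (simp add: a_minus_def)
  ultimately show ?thesis using coset_eq_iff[OF A x, of "\<zero>\<^bsub>V\<^esub>"] by simp
qed

lemma Union_cosets:
  assumes A: "A \<in> subspaces K V" and X: "X \<in> subspaces K V" and AX: "A \<subseteq> X"
  shows "\<Union> ((\<lambda>x. A +>\<^bsub>V\<^esub> x) ` X) = X"
proof
  show "\<Union> ((\<lambda>x. A +>\<^bsub>V\<^esub> x) ` X) \<subseteq> X"
    using AX subspacesD(3)[OF X] by (auto simp: a_r_coset_def')
  show "X \<subseteq> \<Union> ((\<lambda>x. A +>\<^bsub>V\<^esub> x) ` X)"
    using abelian_subgroup.a_rcos_self[OF subspace_abelian_subgroup[OF A]] subspacesD(6)[OF X] by blast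
qed

text \<open>The vector space structure of the quotient is a premise because wherever this is
  applied, a linear map defined on the quotient is at hand and already provides it.\<close>

lemma linear_map_coset:
  assumes A: "A \<in> subspaces K V" and Q: "vectorspace K (quotient_space V A)"
  shows "linear_map K V (quotient_space V A) (\<lambda>x. A +>\<^bsub>V\<^esub> x)"
  by (rule linear_mapI[OF vectorspace_axioms Q]) (simp_all add: coset_add[OF A] coset_smult[OF A])

text \<open>The first isomorphism theorem. The quotient obtains its vector space axioms from
  \<open>W\<close> along the induced bijection, whose value at a coset is \<open>f\<close> at a
  chosen representative; the kernel condition makes this choice immaterial.\<close>

lemma linear_map_quotient:
  assumes A: "A \<in> subspaces K V" and f: "linear_map K V W f"
    and surj: "f ` carrier V = carrier W" and ker: "{x \<in> carrier V. f x = \<zero>\<^bsub>W\<^esub>} = A"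
  obtains t where "linear_map K (quotient_space V A) W t"
    "bij_betw t (carrier (quotient_space V A)) (carrier W)"
    "\<And>x. x \<in> carrier V \<Longrightarrow> t (A +>\<^bsub>V\<^esub> x) = f x"
proof -
  interpret W: vectorspace K W using f by (rule linear_mapD)
  note D = linear_mapD[OF f]
  define t where "t Y = f (SOME x. x \<in> carrier V \<and> Y = A +>\<^bsub>V\<^esub> x)" for Y
  have eq: "A +>\<^bsub>V\<^esub> x = A +>\<^bsub>V\<^esub> y \<longleftrightarrow> f x = f y" if xy: "x \<in> carrier V" "y \<in> carrier V" for x y
  proof -
    have "x \<ominus>\<^bsub>V\<^esub> y \<in> A \<longleftrightarrow> f x \<ominus>\<^bsub>W\<^esub> f y = \<zero>\<^bsub>W\<^esub>"
      unfolding ker[symmetric] using xy by (simp add: D)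
    also have "\<dots> \<longleftrightarrow> f x = f y" using D(3) xy by simp
    finally show ?thesis by (simp add: coset_eq_iff[OF A xy])
  qed
  have t: "t (A +>\<^bsub>V\<^esub> x) = f x" if x: "x \<in> carrier V" for x
  proof -
    let ?y = "SOME y. y \<in> carrier V \<and> A +>\<^bsub>V\<^esub> x = A +>\<^bsub>V\<^esub> y"
    have y: "?y \<in> carrier V \<and> A +>\<^bsub>V\<^esub> x = A +>\<^bsub>V\<^esub> ?y"
      using x by (intro someI[of "\<lambda>y. y \<in> carrier V \<and> A +>\<^bsub>V\<^esub> x = A +>\<^bsub>V\<^esub> y" x]) simp
    have "f x = f ?y" using eq[OF x conjunct1[OF y]] conjunct2[OF y] by blast
    then show ?thesis by (simp add: t_def)
  qed
  have bij: "bij_betw t (carrier (quotient_space V A)) (carrier W)"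
    unfolding bij_betw_def
  proof
    show "inj_on t (carrier (quotient_space V A))"
      by (rule inj_onI) (clarsimp simp: t, simp add: eq)
    show "t ` carrier (quotient_space V A) = carrier W"
      using surj by (simp add: image_image t)
  qed
  have "A = A +>\<^bsub>V\<^esub> \<zero>\<^bsub>V\<^esub>" using coset_eq_self_iff[OF A, of "\<zero>\<^bsub>V\<^esub>"] subspacesD(2)[OF A] by simp
  then have tA: "t A = \<zero>\<^bsub>W\<^esub>" "A \<in> (\<lambda>x. A +>\<^bsub>V\<^esub> x) ` carrier V"
    using t[of "\<zero>\<^bsub>V\<^esub>"] D(6) by auto
  have "linear_map K (quotient_space V A) W t"
    by (rule vectorspace_pullback[OF W.vectorspace_axioms bij])
      (use tA in \<open>auto simp: coset_add[OF A] coset_smult[OF A] t D\<close>)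
  then show thesis using bij t that by blast
qed

end

text \<open>An isomorphism from the minor N[A, B] to \<open>M\<close>, seen from \<open>B\<close>: a
  surjection with kernel \<open>A\<close>. It speaks of vectors of \<open>N\<close> instead of
  cosets, so that the maps at different steps of a chain can be combined on one space.\<close>

definition minor_map :: "('k, 'x) ring_scheme \<Rightarrow> ('k, 'v) qmat \<Rightarrow> 'v set \<Rightarrow> 'v set \<Rightarrow>
    ('k, 'w) qmat \<Rightarrow> ('v \<Rightarrow> 'w) \<Rightarrow> bool" where
  "minor_map K N A B M f \<longleftrightarrow>
     linear_map K ((space N)\<lparr>carrier := B\<rparr>) (space M) f \<and>
     f ` B = carrier (space M) \<and> {x \<in> B. f x = \<zero>\<^bsub>space M\<^esub>} = A \<and>
     (\<forall>X \<in> subspaces K (space N). A \<subseteq> X \<longrightarrow> X \<subseteq> B \<longrightarrow> rk M (f ` X) = rk N X - rk N A)"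

text \<open>Composition with the coset map turns an isomorphism into a surjection with kernel
  \<open>A\<close>, and factoring through the quotient reverses this. Ranks match because subspaces
  of the quotient correspond to the spaces between \<open>A\<close> and \<open>B\<close>.\<close>

lemma qm_iso_minor_iff:
  assumes N: "vectorspace K (space N)" and A: "A \<in> subspaces K (space N)"
    and B: "B \<in> subspaces K (space N)" and AB: "A \<subseteq> B"
  shows "qm_iso K (minor N A B) M \<longleftrightarrow> (\<exists>f. minor_map K N A B M f)"
proof -
  interpret N: plain_vectorspace K "space N" unfolding plain_vectorspace_iff by (rule N)
  let ?B = "(space N)\<lparr>carrier := B\<rparr>"
  let ?Q = "quotient_space ?B A"
  let ?c = "\<lambda>x. A +>\<^bsub>?B\<^esub> x"
  interpret B: plain_vectorspace K ?B
    unfolding plain_vectorspace_iff by (rule N.subspace_is_vectorspace[OF B])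
  have AB': "A \<in> subspaces K ?B" using A AB by (simp add: N.subspaces_restrict[OF B])
  have space: "space (minor N A B) = ?Q" and rk: "\<And>Y. rk (minor N A B) Y = rk N (\<Union>Y) - rk N A"
    by (simp_all add: minor_def)
  have Un: "\<Union> (?c ` X) = X" if "X \<in> subspaces K (space N)" "A \<subseteq> X" "X \<subseteq> B" for X
    using that by (intro B.Union_cosets[OF AB']) (simp_all add: N.subspaces_restrict[OF B])
  show ?thesis
  proof
    assume "qm_iso K (minor N A B) M"
    then obtain t where t: "linear_map K ?Q (space M) t"
      and bij: "bij_betw t (carrier ?Q) (carrier (space M))"
      and rt: "\<And>Y. Y \<in> subspaces K ?Q \<Longrightarrow> rk M (t ` Y) = rk N (\<Union>Y) - rk N A"
      by (auto simp: qm_iso_def space rk)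
    have c: "linear_map K ?B ?Q ?c"
      by (rule B.linear_map_coset[OF AB' linear_mapD(1)[OF t]])
    have "{x \<in> B. t (?c x) = \<zero>\<^bsub>space M\<^esub>} = A"
    proof -
      have "t (?c x) = \<zero>\<^bsub>space M\<^esub> \<longleftrightarrow> x \<in> A" if x: "x \<in> B" for x
      proof -
        have "A \<in> carrier ?Q" using B.coset_eq_self_iff[OF AB', of "\<zero>\<^bsub>?B\<^esub>"]
          N.subspacesD(2)[OF A] N.subspacesD(2)[OF B] by (auto simp: image_iff)
        then have "t (?c x) = t A \<longleftrightarrow> ?c x = A"
          using inj_on_eq_iff[OF bij_betw_imp_inj_on[OF bij]] x by simp
        moreover have "t A = \<zero>\<^bsub>space M\<^esub>" using linear_mapD(6)[OF t] by simp
        ultimately show ?thesis using B.coset_eq_self_iff[OF AB', of x] x by simp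
      qed
      then show ?thesis using AB by auto
    qed
    moreover have "(\<lambda>x. t (?c x)) ` B = carrier (space M)"
      using bij_betw_imp_surj_on[OF bij] by (simp add: image_image)
    moreover have "rk M ((\<lambda>x. t (?c x)) ` X) = rk N X - rk N A"
      if X: "X \<in> subspaces K (space N)" "A \<subseteq> X" "X \<subseteq> B" for X
    proof -
      have "X \<in> subspaces K ?B" using X by (simp add: N.subspaces_restrict[OF B])
      then have "rk M (t ` ?c ` X) = rk N (\<Union> (?c ` X)) - rk N A"
        by (intro rt image_in_subspaces[OF c])
      then show ?thesis by (simp add: Un[OF X] image_image)
    qed
    ultimately show "\<exists>f. minor_map K N A B M f"
      using linear_map_comp[OF c t] by (auto simp: minor_map_def)
  next
    assume "\<exists>f. minor_map K N A B M f"
    then obtain f where f: "linear_map K ?B (space M) f" and surj: "f ` B = carrier (space M)"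
      and ker: "{x \<in> B. f x = \<zero>\<^bsub>space M\<^esub>} = A"
      and rf: "\<And>X. X \<in> subspaces K (space N) \<Longrightarrow> A \<subseteq> X \<Longrightarrow> X \<subseteq> B \<Longrightarrow>
        rk M (f ` X) = rk N X - rk N A"
      by (auto simp: minor_map_def)
    obtain t where t: "linear_map K ?Q (space M) t"
      and bij: "bij_betw t (carrier ?Q) (carrier (space M))"
      and tc: "\<And>x. x \<in> B \<Longrightarrow> t (?c x) = f x"
      using B.linear_map_quotient[OF AB' f] surj ker by auto
    have c: "linear_map K ?B ?Q ?c"
      by (rule B.linear_map_coset[OF AB' linear_mapD(1)[OF t]])
    have "rk M (t ` Y) = rk N (\<Union>Y) - rk N A" if Y: "Y \<in> subspaces K ?Q" for Y
    proof -
      interpret Q: plain_vectorspace K ?Q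
        unfolding plain_vectorspace_iff by (rule linear_mapD(1)[OF t])
      \<comment> \<open>The space between \<open>A\<close> and \<open>B\<close> that corresponds to
        \<open>Y\<close>: it is the union of the cosets in \<open>Y\<close>, and \<open>f\<close>
        maps it onto the image of \<open>Y\<close> under \<open>t\<close>.\<close>
      let ?X = "{x \<in> B. ?c x \<in> Y}"
      have X: "?X \<in> subspaces K (space N)"
        using vimage_in_subspaces[OF c Y] by (simp add: N.subspaces_restrict[OF B])
      have AX: "A \<subseteq> ?X"
      proof
        fix x assume x: "x \<in> A"
        then have "?c x = A" using B.coset_eq_self_iff[OF AB', of x] AB by auto
        then show "x \<in> ?X" using x AB Q.subspacesD(2)[OF Y] by auto
      qed
      have "Y = ?c ` ?X" using Q.subspacesD(1)[OF Y] by auto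
      moreover have "\<Union> (?c ` ?X) = ?X" using AX by (intro Un[OF X]) auto
      moreover have "t ` ?c ` ?X = f ` ?X"
        unfolding image_image by (rule image_cong) (simp_all add: tc)
      ultimately have "\<Union>Y = ?X" "t ` Y = f ` ?X" by metis+
      then show ?thesis using rf[OF X AX] by simp
    qed
    then show "qm_iso K (minor N A B) M"
      using t bij by (auto simp: qm_iso_def space rk)
  qed
qed

text \<open>The chain starts at an arbitrary subspace \<open>A\<close>, so that inductions along it stay in one
  ambient space instead of passing to the quotient by its first term, whose type differs.\<close>

fun flag :: "('k, 'x) ring_scheme \<Rightarrow> ('k, 'w) qmat \<Rightarrow> 'w set \<Rightarrow> ('k, 'v) qmat list \<Rightarrow> bool" where
  "flag K N A [] \<longleftrightarrow> A = carrier (space N)"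
| "flag K N A (M # Ms) \<longleftrightarrow>
     (\<exists>B f. B \<in> subspaces K (space N) \<and> A \<subset> B \<and> minor_map K N A B M f \<and> flag K N B Ms)"

lemma flag_iff:
  assumes N: "vectorspace K (space N)" and A: "A \<in> subspaces K (space N)"
  shows "flag K N A Ms \<longleftrightarrow>
    (\<exists>V. V 0 = A \<and> V (length Ms) = carrier (space N) \<and>
      (\<forall>i \<le> length Ms. V i \<in> subspaces K (space N)) \<and>
      (\<forall>i < length Ms. V i \<subset> V (Suc i) \<and> qm_iso K (minor N (V i) (V (Suc i))) (Ms ! i)))"
  using A
proof (induction Ms arbitrary: A)
  case Nil
  then show ?case by (auto intro: exI[of _ "\<lambda>_. A"])
next
  case (Cons M Ms)
  show ?case (is "_ \<longleftrightarrow> (\<exists>V. ?P V)")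
  proof
    assume "flag K N A (M # Ms)"
    then obtain B f where B: "B \<in> subspaces K (space N)" and AB: "A \<subset> B"
      and f: "minor_map K N A B M f" and "flag K N B Ms"
      by auto
    then obtain V where V: "V 0 = B" "V (length Ms) = carrier (space N)"
      "\<And>i. i \<le> length Ms \<Longrightarrow> V i \<in> subspaces K (space N)"
      "\<And>i. i < length Ms \<Longrightarrow> V i \<subset> V (Suc i) \<and> qm_iso K (minor N (V i) (V (Suc i))) (Ms ! i)"
      using Cons.IH[OF B] by auto
    have "qm_iso K (minor N A B) M"
      using qm_iso_minor_iff[OF N Cons.prems B, of M] AB f by blast
    then have "?P (case_nat A V)"
      using V Cons.prems AB by (auto split: nat.split simp: less_Suc_eq_0_disj)
    then show "\<exists>V. ?P V" by blast
  next
    assume "\<exists>V. ?P V"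
    then obtain V where V: "?P V" by blast
    have V1: "V 1 \<in> subspaces K (space N)" "A \<subset> V 1" "qm_iso K (minor N A (V 1)) M"
      using V by auto
    then obtain f where f: "minor_map K N A (V 1) M f"
      using qm_iso_minor_iff[OF N Cons.prems V1(1), of M] by blast
    have "flag K N (V 1) Ms"
      unfolding Cons.IH[OF V1(1)] using V by (intro exI[of _ "\<lambda>i. V (Suc i)"]) auto
    then show "flag K N A (M # Ms)" using V1 f by auto
  qed
qed

lemma Mq_iff:
  "N \<in> Mq K Ms \<longleftrightarrow> q_matroid K N \<and> flag K N {\<zero>\<^bsub>space N\<^esub>} Ms"
proof (cases "q_matroid K N")
  case True
  then have N: "vectorspace K (space N)" by (simp add: q_matroid_def)
  then have "{\<zero>\<^bsub>space N\<^esub>} \<in> subspaces K (space N)"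
    by (intro plain_vectorspace.zero_in_subspaces) (simp add: plain_vectorspace_iff)
  from flag_iff[OF N this, of Ms] show ?thesis using True by (simp add: Mq_def)
qed (simp add: Mq_def)

section \<open>A flag in the iterated free product\<close>

lemma minor_mapI:
  assumes "linear_map K (space N) (space M) f" "B \<in> subspaces K (space N)"
    and "f ` B = carrier (space M)" "{x \<in> B. f x = \<zero>\<^bsub>space M\<^esub>} = A"
    and "\<And>X. X \<in> subspaces K (space N) \<Longrightarrow> A \<subseteq> X \<Longrightarrow> X \<subseteq> B \<Longrightarrow> rk M (f ` X) = rk N X - rk N A"
  shows "minor_map K N A B M f"
  unfolding minor_map_def using linear_map_restrict[OF assms(1,2)] assms(3,4,5) by simp

lemma flag_ConsI:
  assumes "B \<in> subspaces K (space N)" "A \<subset> B" "minor_map K N A B M f" "flag K N B Ms"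
  shows "flag K N A (M # Ms)"
  unfolding flag.simps by (intro exI conjI) (rule assms)+

lemma flag_ConsE:
  assumes "flag K N A (M # Ms)"
  obtains B f where "B \<in> subspaces K (space N)" "A \<subset> B" "minor_map K N A B M f" "flag K N B Ms"
  using assms that unfolding flag.simps by metis

lemma minor_map_image:
  assumes t: "linear_map K (space N) (space N') t"
    and bij: "bij_betw t (carrier (space N)) (carrier (space N'))"
    and rk: "\<And>X. X \<in> subspaces K (space N) \<Longrightarrow> rk N' (t ` X) = rk N X"
    and A: "A \<in> subspaces K (space N)" and B: "B \<in> subspaces K (space N)"
    and f: "minor_map K N A B M f"
  shows "minor_map K N' (t ` A) (t ` B) M (\<lambda>x. f (inv_into (carrier (space N)) t x))"
proof -
  let ?g = "inv_into (carrier (space N)) t"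
  interpret N: plain_vectorspace K "space N" unfolding plain_vectorspace_iff using t by (rule linear_mapD)
  interpret N': plain_vectorspace K "space N'" unfolding plain_vectorspace_iff using t by (rule linear_mapD)
  have inj: "inj_on t (carrier (space N))" using bij by (rule bij_betw_imp_inj_on)
  have gt: "?g (t x) = x" if "x \<in> carrier (space N)" for x
    using inv_into_f_f[OF inj that] .
  note BN = N.subspacesD[OF B] and AN = N.subspacesD[OF A]
  have tB: "t ` B \<in> subspaces K (space N')" by (rule image_in_subspaces[OF t B])
  note f = f[unfolded minor_map_def]
  have "linear_map K ((space N')\<lparr>carrier := t ` B\<rparr>) ((space N)\<lparr>carrier := B\<rparr>) ?g"
    by (rule linear_map_codomain[OF linear_map_restrict[OF linear_map_inv_into[OF t bij] tB] B])
      (use gt BN in auto)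
  then have "linear_map K ((space N')\<lparr>carrier := t ` B\<rparr>) (space M) (\<lambda>x. f (?g x))"
    by (rule linear_map_comp) (use f in blast)
  moreover have im: "(\<lambda>x. f (?g x)) ` t ` X = f ` X" if "X \<subseteq> carrier (space N)" for X
    unfolding image_image using that by (intro image_cong) (auto simp: gt)
  then have "(\<lambda>x. f (?g x)) ` t ` B = carrier (space M)" using BN(1) f by simp
  moreover have "{x \<in> t ` B. f (?g x) = \<zero>\<^bsub>space M\<^esub>} = t ` A"
  proof -
    have "{x \<in> t ` B. f (?g x) = \<zero>\<^bsub>space M\<^esub>} = t ` {x \<in> B. f x = \<zero>\<^bsub>space M\<^esub>}"
      using gt BN(6) by auto
    then show ?thesis using f by simp
  qed
  moreover have "rk M ((\<lambda>x. f (?g x)) ` Y) = rk N' Y - rk N' (t ` A)"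
    if Y: "Y \<in> subspaces K (space N')" "t ` A \<subseteq> Y" "Y \<subseteq> t ` B" for Y
  proof -
    let ?X = "{x \<in> carrier (space N). t x \<in> Y}"
    have X: "?X \<in> subspaces K (space N)" by (rule vimage_in_subspaces[OF t Y(1)])
    have YX: "t ` ?X = Y" by (rule image_vimage_bij[OF bij N'.subspacesD(1)[OF Y(1)]])
    have "A \<subseteq> ?X" using Y(2) AN by auto
    moreover have "?X \<subseteq> B"
    proof
      fix x assume "x \<in> ?X"
      then have "x \<in> carrier (space N)" "t x \<in> t ` B" using Y(3) by auto
      then show "x \<in> B" using inj_on_image_mem_iff[OF inj _ BN(1)] by blast
    qed
    ultimately have "rk M (f ` ?X) = rk N ?X - rk N A" using f X by blast
    then show ?thesis using rk[OF X] rk[OF A] im[of ?X] YX by simp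
  qed
  ultimately show ?thesis unfolding minor_map_def by simp
qed

text \<open>Flags are constructed in the direct sum with the explicit rank \<open>fp_rank\<close>;
  this moves them to the copy on lists, where the iterated product lives.\<close>

lemma flag_image:
  assumes t: "linear_map K (space N) (space N') t"
    and bij: "bij_betw t (carrier (space N)) (carrier (space N'))"
    and rk: "\<And>X. X \<in> subspaces K (space N) \<Longrightarrow> rk N' (t ` X) = rk N X"
  shows "A \<in> subspaces K (space N) \<Longrightarrow> flag K N A Ms \<Longrightarrow> flag K N' (t ` A) Ms"
proof (induction Ms arbitrary: A)
  case Nil
  then show ?case using bij_betw_imp_surj_on[OF bij] by simp
next
  case (Cons M Ms)
  interpret N: plain_vectorspace K "space N" unfolding plain_vectorspace_iff using t by (rule linear_mapD)
  obtain B f where B: "B \<in> subspaces K (space N)" and AB: "A \<subset> B"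
    and f: "minor_map K N A B M f" and "flag K N B Ms"
    using flag_ConsE[OF Cons.prems(2)] by blast
  then have fl: "flag K N' (t ` B) Ms" by (intro Cons.IH)
  have "t ` A \<subset> t ` B"
    using AB inj_on_subset[OF bij_betw_imp_inj_on[OF bij] N.subspacesD(1)[OF B]]
    by (rule image_strict_mono[rotated])
  moreover have "minor_map K N' (t ` A) (t ` B) M (\<lambda>x. f (inv_into (carrier (space N)) t x))"
    using t bij rk Cons.prems(1) B f by (rule minor_map_image)
  ultimately show ?case using fl by (rule flag_ConsI[OF image_in_subspaces[OF t B]])
qed

text \<open>On spaces containing E1 the first term attains the minimum, because rank in
  \<open>M2\<close> is at most dimension. Hence contracting E1 leaves \<open>M2\<close>.\<close>

lemma fp_rank_Times:
  assumes M1: "finite_q_matroid K (space M1) (rk M1)" and M2: "finite_q_matroid K (space M2) (rk M2)"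
    and Y: "Y \<in> subspaces K (space M2)"
  shows "fp_rank K M1 M2 (carrier (space M1) \<times> Y) = rk M1 (carrier (space M1)) + rk M2 Y"
proof -
  interpret M1: finite_q_matroid K "space M1" "rk M1" by fact
  interpret M2: finite_q_matroid K "space M2" "rk M2" by fact
  have "snd ` (carrier (space M1) \<times> Y) = Y" using M1.M.zero_closed by auto
  moreover have "left_part (space M1) (space M2) (carrier (space M1) \<times> Y) = carrier (space M1)"
    using M2.subspacesD(2)[OF Y] by (auto simp: mem_left_part_iff)
  ultimately show ?thesis using M2.rank_le_sdim[OF Y] by (simp add: fp_rank_def)
qed

text \<open>The flag of \<open>M2\<close> is pulled back along the second projection. Each term then
  contains E1, and adding the constant rank of E1 does not affect differences of ranks.\<close>

lemma flag_fp_rank_right: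
  assumes M1: "finite_q_matroid K (space M1) (rk M1)" and M2: "finite_q_matroid K (space M2) (rk M2)"
  shows "A \<in> subspaces K (space M2) \<Longrightarrow> flag K M2 A Ms \<Longrightarrow>
    flag K (direct_sum (space M1) (space M2), fp_rank K M1 M2) (carrier (space M1) \<times> A) Ms"
proof (induction Ms arbitrary: A)
  case Nil
  then show ?case by simp
next
  case (Cons M Ms)
  let ?D = "direct_sum (space M1) (space M2)" and ?E = "carrier (space M1)"
  interpret M1: finite_q_matroid K "space M1" "rk M1" by fact
  interpret M2: finite_q_matroid K "space M2" "rk M2" by fact
  interpret D: plain_vectorspace K ?D
    unfolding plain_vectorspace_iff
    by (rule direct_sum_is_vs[OF M1.vectorspace_axioms M2.vectorspace_axioms])
  have snd: "linear_map K ?D (space M2) snd"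
    by (rule linear_map_snd[OF M1.vectorspace_axioms M2.vectorspace_axioms])
  have Times: "?E \<times> Y \<in> subspaces K ?D" if "Y \<in> subspaces K (space M2)" for Y
  proof -
    have "{p \<in> carrier ?D. snd p \<in> Y} = ?E \<times> Y" using M2.subspacesD(1)[OF that] by auto
    then show ?thesis using vimage_in_subspaces[OF snd that] by simp
  qed
  have ne: "?E \<noteq> {}" using M1.M.zero_closed by auto
  obtain B f where B: "B \<in> subspaces K (space M2)" and AB: "A \<subset> B"
    and f: "minor_map K M2 A B M f" and "flag K M2 B Ms"
    using flag_ConsE[OF Cons.prems(2)] by blast
  then have fl: "flag K (?D, fp_rank K M1 M2) (?E \<times> B) Ms" by (intro Cons.IH)
  note f = f[unfolded minor_map_def]
  interpret B: vectorspace K "(space M2)\<lparr>carrier := B\<rparr>" by (rule M2.subspace_is_vectorspace[OF B])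
  have im: "(\<lambda>p. f (snd p)) ` (?E \<times> Y) = f ` Y" for Y
    using ne by (force simp: image_iff)
  have "linear_map K (?D\<lparr>carrier := ?E \<times> B\<rparr>) ((space M2)\<lparr>carrier := B\<rparr>) snd"
    by (rule linear_map_codomain[OF linear_map_restrict[OF snd Times[OF B]] B]) auto
  then have "linear_map K (?D\<lparr>carrier := ?E \<times> B\<rparr>) (space M) (\<lambda>p. f (snd p))"
    by (rule linear_map_comp) (use f in blast)
  moreover have "(\<lambda>p. f (snd p)) ` (?E \<times> B) = carrier (space M)" using im f by simp
  moreover have "{p \<in> ?E \<times> B. f (snd p) = \<zero>\<^bsub>space M\<^esub>} = ?E \<times> A"
    using f by auto
  moreover have "rk M ((\<lambda>p. f (snd p)) ` X) = fp_rank K M1 M2 X - fp_rank K M1 M2 (?E \<times> A)"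
    if X: "X \<in> subspaces K ?D" "?E \<times> A \<subseteq> X" "X \<subseteq> ?E \<times> B" for X
  proof -
    let ?Y = "snd ` X"
    have Y: "?Y \<in> subspaces K (space M2)" by (rule image_in_subspaces[OF snd X(1)])
    \<comment> \<open>Since \<open>A\<close> contains zero, \<open>X\<close> contains E1 \<times> 0;
      the first entry of a vector in \<open>X\<close> can therefore be changed at will within
      E1.\<close>
    have XY: "X = ?E \<times> ?Y"
    proof (intro equalityI subsetI)
      fix p assume "p \<in> X"
      then show "p \<in> ?E \<times> ?Y" using X(3) by (force simp: image_iff)
    next
      fix p assume p: "p \<in> ?E \<times> ?Y"
      then obtain x y x' where xy: "p = (x, y)" "x \<in> ?E" "(x', y) \<in> X" by auto
      then have x': "x' \<in> ?E" "y \<in> B" using X(3) by auto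
      then have yV: "y \<in> carrier (space M2)" using M2.subspacesD(1)[OF B] by auto
      have "(x \<ominus>\<^bsub>space M1\<^esub> x', \<zero>\<^bsub>space M2\<^esub>) \<in> X"
        using X(2) xy(2) x'(1) M2.subspacesD(2)[OF Cons.prems(1)] by auto
      from D.subspacesD(3)[OF X(1) this xy(3)]
      have "(x \<ominus>\<^bsub>space M1\<^esub> x' \<oplus>\<^bsub>space M1\<^esub> x', y) \<in> X"
        using yV by (simp add: direct_sum_def)
      moreover have "x \<ominus>\<^bsub>space M1\<^esub> x' \<oplus>\<^bsub>space M1\<^esub> x' = x"
        using xy(2) x'(1) by (simp add: a_minus_def M1.M.a_assoc M1.M.l_neg)
      ultimately show "p \<in> X" using xy by simp
    qed
    have AY: "A \<subseteq> ?Y" using X(2) ne by force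
    have YB: "?Y \<subseteq> B" using X(3) by auto
    have "rk M (f ` ?Y) = rk M2 ?Y - rk M2 A" using f Y AY YB by blast
    moreover have "(\<lambda>p. f (snd p)) ` X = f ` ?Y" by (simp add: image_image)
    moreover have "fp_rank K M1 M2 X = rk M1 ?E + rk M2 ?Y"
      by (subst XY) (rule fp_rank_Times[OF M1 M2 Y])
    ultimately show ?thesis using fp_rank_Times[OF M1 M2 Cons.prems(1)] by simp
  qed
  ultimately have "minor_map K (?D, fp_rank K M1 M2) (?E \<times> A) (?E \<times> B) M (\<lambda>p. f (snd p))"
    unfolding minor_map_def by simp
  moreover have "?E \<times> A \<subset> ?E \<times> B" using AB ne by blast
  ultimately show ?case
    by (intro flag_ConsI[of "?E \<times> B"]) (simp_all add: Times[OF B] fl)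
qed

text \<open>Inside E1 \<times> 0 the second term attains the minimum and equals the rank in
  \<open>M1\<close>, so the step from zero to E1 \<times> 0 has minor \<open>M1\<close>; it is
  strict because E1 is nonzero. The pulled-back flag of \<open>M2\<close> continues from
  there.\<close>

lemma flag_fp_rank:
  assumes M1: "finite_q_matroid K (space M1) (rk M1)" and M2: "finite_q_matroid K (space M2) (rk M2)"
    and nz: "carrier (space M1) \<noteq> {\<zero>\<^bsub>space M1\<^esub>}"
    and fl: "flag K M2 {\<zero>\<^bsub>space M2\<^esub>} Ms"
  shows "flag K (direct_sum (space M1) (space M2), fp_rank K M1 M2)
    {\<zero>\<^bsub>direct_sum (space M1) (space M2)\<^esub>} (M1 # Ms)"
proof -
  let ?D = "direct_sum (space M1) (space M2)" and ?E = "carrier (space M1)"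
  interpret M1: finite_q_matroid K "space M1" "rk M1" by fact
  interpret M2: finite_q_matroid K "space M2" "rk M2" by fact
  note vs = M1.vectorspace_axioms M2.vectorspace_axioms
  have fst: "linear_map K ?D (space M1) fst" by (rule linear_map_fst[OF vs])
  have snd: "linear_map K ?D (space M2) snd" by (rule linear_map_snd[OF vs])
  let ?B = "?E \<times> {\<zero>\<^bsub>space M2\<^esub>}"
  have "{p \<in> carrier ?D. snd p = \<zero>\<^bsub>space M2\<^esub>} = ?B" by auto
  then have B: "?B \<in> subspaces K ?D" using kernel_in_subspaces[OF snd] by simp
  have rB: "fp_rank K M1 M2 X = rk M1 (fst ` X)" if X: "X \<in> subspaces K ?D" "X \<subseteq> ?B" for X
  proof -
    interpret D: plain_vectorspace K ?D
      unfolding plain_vectorspace_iff by (rule direct_sum_is_vs[OF vs])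
    have F: "fst ` X \<in> subspaces K (space M1)" by (rule image_in_subspaces[OF fst X(1)])
    have "snd ` X = {\<zero>\<^bsub>space M2\<^esub>}" using X(2) D.subspacesD(2)[OF X(1)] by force
    moreover have "left_part (space M1) (space M2) X = fst ` X"
      using X(2) by (force simp: mem_left_part_iff image_iff)
    ultimately show ?thesis
      using M1.rank_mono[OF F M1.carrier_in_subspaces M1.subspacesD(1)[OF F]] M2.rank_zero M2.sdim_zero
      by (simp add: fp_rank_def)
  qed
  have "minor_map K (?D, fp_rank K M1 M2) {\<zero>\<^bsub>?D\<^esub>} ?B M1 fst"
  proof (rule minor_mapI)
    show "fst ` ?B = carrier (space M1)" by force
    show "{x \<in> ?B. fst x = \<zero>\<^bsub>space M1\<^esub>} = {\<zero>\<^bsub>?D\<^esub>}" by auto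
    fix X assume "X \<in> subspaces K (space (?D, fp_rank K M1 M2))" "X \<subseteq> ?B"
    moreover have "fp_rank K M1 M2 {\<zero>\<^bsub>?D\<^esub>} = 0"
      using rB[of "{\<zero>\<^bsub>?D\<^esub>}"] M1.rank_zero plain_vectorspace.zero_in_subspaces[of K ?D]
        direct_sum_is_vs[OF vs]
      by (simp add: plain_vectorspace_iff)
    ultimately show "rk M1 (fst ` X) =
        rk (?D, fp_rank K M1 M2) X - rk (?D, fp_rank K M1 M2) {\<zero>\<^bsub>?D\<^esub>}"
      using rB[of X] by simp
  qed (use fst B in simp_all)
  moreover have "{\<zero>\<^bsub>?D\<^esub>} \<subset> ?B"
  proof -
    obtain x where "x \<in> ?E" "x \<noteq> \<zero>\<^bsub>space M1\<^esub>" using nz M1.M.zero_closed by blast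
    then have "(x, \<zero>\<^bsub>space M2\<^esub>) \<in> ?B" "(x, \<zero>\<^bsub>space M2\<^esub>) \<notin> {\<zero>\<^bsub>?D\<^esub>}" by simp_all
    moreover have "{\<zero>\<^bsub>?D\<^esub>} \<subseteq> ?B" using M1.M.zero_closed by simp
    ultimately show ?thesis by blast
  qed
  moreover have "flag K (?D, fp_rank K M1 M2) ?B Ms"
    by (rule flag_fp_rank_right[OF M1 M2 M2.zero_in_subspaces fl])
  ultimately show ?thesis
    by (intro flag_ConsI[of ?B]) (simp_all add: B)
qed

section \<open>From two factors to the iterated product\<close>

lemma inj_Cons_pair: "inj (\<lambda>(x, xs). x # xs)"
  by (auto simp: inj_on_def)

text \<open>For two or more factors, the later arguments use the product only through this
  isomorphism, which hides both the chosen rank function and the encoding by lists.\<close>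

lemma free_products_Cons_iso:
  assumes K: "finite (carrier K)" and M: "q_matroid K M" and P: "q_matroid K (free_products K (M' # Ms))"
  defines "D \<equiv> direct_sum (space M) (space (free_products K (M' # Ms)))"
  obtains t where "linear_map K D (space (free_products K (M # M' # Ms))) t"
    "bij_betw t (carrier D) (carrier (space (free_products K (M # M' # Ms))))"
    "\<And>X. X \<in> subspaces K D \<Longrightarrow>
      rk (free_products K (M # M' # Ms)) (t ` X) = fp_rank K M (free_products K (M' # Ms)) X"
proof -
  let ?F = "free_product K M (free_products K (M' # Ms))"
  have sp: "space ?F = D" by (simp add: space_free_product D_def)
  have "vectorspace K (space ?F)"
    using free_product_rank(1)[OF K M P] by (simp add: q_matroid_def)
  note iso = transport_iso[OF inj_Cons_pair this]
  show thesis
  proof (rule that)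
    show "linear_map K D (space (free_products K (M # M' # Ms))) (\<lambda>(x, xs). x # xs)"
      using iso(1) by (simp add: sp)
    show "bij_betw (\<lambda>(x, xs). x # xs) (carrier D) (carrier (space (free_products K (M # M' # Ms))))"
      using iso(2) by (simp add: sp)
    show "rk (free_products K (M # M' # Ms)) ((\<lambda>(x, xs). x # xs) ` X) =
        fp_rank K M (free_products K (M' # Ms)) X" if "X \<in> subspaces K D" for X
      using iso(3)[of X] free_product_rank(2)[OF K M P that[unfolded D_def]] by simp
  qed
qed

lemma q_matroid_image:
  assumes K: "finite (carrier K)" and M: "q_matroid K M" and "linear_map K (space M) (space N) t"
    and "bij_betw t (carrier (space M)) (carrier (space N))"
    and "\<And>X. X \<in> subspaces K (space M) \<Longrightarrow> rk N (t ` X) = rk M X"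
  shows "q_matroid K N"
  unfolding q_matroid_iff[OF K]
  by (rule finite_q_matroid_image[OF M[unfolded q_matroid_iff[OF K]] assms(3,4)]) (rule assms(5))

text \<open>Both claims go through one induction: the rank formula for the next product needs the
  product of the tail to be a q-matroid, and its flag extends the flag of the tail.\<close>

lemma free_products_flag:
  assumes K: "finite (carrier K)"
  shows "Ms \<noteq> [] \<Longrightarrow> \<forall>M \<in> set Ms. q_matroid K M \<and> carrier (space M) \<noteq> {\<zero>\<^bsub>space M\<^esub>} \<Longrightarrow>
    q_matroid K (free_products K Ms) \<and>
    flag K (free_products K Ms) {\<zero>\<^bsub>space (free_products K Ms)\<^esub>} Ms"
proof (induction Ms)
  case Nil
  then show ?case by simp
next
  case (Cons M Ms)
  then have M: "q_matroid K M" and nz: "carrier (space M) \<noteq> {\<zero>\<^bsub>space M\<^esub>}" by simp_all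
  interpret M: finite_q_matroid K "space M" "rk M" using M by (simp add: q_matroid_iff[OF K])
  show ?case
  proof (cases Ms)
    case Nil
    let ?P = "transport (\<lambda>x. [x]) M"
    have inj: "inj (\<lambda>x. [x])" by (simp add: inj_on_def)
    note iso = transport_iso[OF inj M.vectorspace_axioms]
    \<comment> \<open>With a single factor the chain is the step from zero to the whole space, and
      the identity realises its minor.\<close>
    have "linear_map K (space M) (space M) (\<lambda>x. x)"
      by (rule linear_mapI) (simp_all add: M.vectorspace_axioms)
    then have "minor_map K M {\<zero>\<^bsub>space M\<^esub>} (carrier (space M)) M (\<lambda>x. x)"
      by (rule minor_mapI) (auto simp: M.carrier_in_subspaces M.rank_zero)
    then have "flag K M {\<zero>\<^bsub>space M\<^esub>} [M]"
      by (rule flag_ConsI[rotated 2]) (use nz M.M.zero_closed M.carrier_in_subspaces in auto)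
    from flag_image[OF iso M.zero_in_subspaces this]
    have "flag K ?P {\<zero>\<^bsub>space ?P\<^esub>} [M]"
      using linear_mapD(6)[OF iso(1)] by simp
    moreover have "q_matroid K ?P" by (rule q_matroid_image[OF K M iso])
    ultimately show ?thesis by (simp add: Nil)
  next
    case (Cons M' Ms')
    let ?P' = "free_products K (M' # Ms')" and ?P = "free_products K (M # M' # Ms')"
    let ?D = "direct_sum (space M) (space ?P')"
    have P': "q_matroid K ?P'" "flag K ?P' {\<zero>\<^bsub>space ?P'\<^esub>} (M' # Ms')"
      using Cons.IH[unfolded Cons] Cons.prems(2) unfolding Cons by simp_all
    obtain t where t: "linear_map K ?D (space ?P) t"
      and bij: "bij_betw t (carrier ?D) (carrier (space ?P))"
      and rk: "\<And>X. X \<in> subspaces K ?D \<Longrightarrow> rk ?P (t ` X) = fp_rank K M ?P' X"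
      by (rule free_products_Cons_iso[OF K M P'(1)]) blast
    let ?N = "(?D, fp_rank K M ?P')"
    note fin = M.finite_q_matroid_axioms P'(1)[unfolded q_matroid_iff[OF K]]
    have "q_matroid K ?N"
      using finite_q_matroid_fp_rank[OF fin] by (simp add: q_matroid_iff[OF K])
    then have "q_matroid K ?P"
      by (rule q_matroid_image[OF K, where t = t]) (simp_all only: fst_conv snd_conv t bij rk)
    moreover have "flag K ?N {\<zero>\<^bsub>?D\<^esub>} (M # M' # Ms')"
      by (rule flag_fp_rank[OF fin nz P'(2)])
    then have "flag K ?P (t ` {\<zero>\<^bsub>?D\<^esub>}) (M # M' # Ms')"
    proof (rule flag_image[where N = ?N and t = t, rotated 4])
      show "{\<zero>\<^bsub>?D\<^esub>} \<in> subspaces K (space ?N)"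
        using plain_vectorspace.zero_in_subspaces[of K ?D] linear_mapD(1)[OF t]
        by (simp add: plain_vectorspace_iff)
    qed (simp_all only: fst_conv snd_conv t bij rk)
    then have "flag K ?P {\<zero>\<^bsub>space ?P\<^esub>} (M # M' # Ms')"
      using linear_mapD(6)[OF t] by simp
    ultimately show ?thesis by (simp add: Cons)
  qed
qed

section \<open>Maximality\<close>

text \<open>The map \<open>h\<close> identifies \<open>N\<close> modulo \<open>A\<close> with the
  product of the remaining factors, and \<open>A\<close> varies in the induction. If
  \<open>B\<close> is the next term of the chain, the map for the tail has kernel \<open>B\<close>;
  pairing it with an extension of \<open>f\<close> to all of \<open>N\<close> splits off
  \<open>M\<close>. The two bounds behind \<open>fp_rank\<close> then apply to
  \<open>N\<close>.\<close>

lemma free_products_dominates: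
  assumes K: "finite (carrier K)" and N: "q_matroid K N"
  shows "Ms \<noteq> [] \<Longrightarrow> \<forall>M \<in> set Ms. q_matroid K M \<and> carrier (space M) \<noteq> {\<zero>\<^bsub>space M\<^esub>} \<Longrightarrow>
    A \<in> subspaces K (space N) \<Longrightarrow> flag K N A Ms \<Longrightarrow>
    \<exists>h. linear_map K (space N) (space (free_products K Ms)) h \<and>
      h ` carrier (space N) = carrier (space (free_products K Ms)) \<and>
      {x \<in> carrier (space N). h x = \<zero>\<^bsub>space (free_products K Ms)\<^esub>} = A \<and>
      (\<forall>X \<in> subspaces K (space N). A \<subseteq> X \<longrightarrow> rk N X - rk N A \<le> rk (free_products K Ms) (h ` X))"
proof (induction Ms arbitrary: A)
  case Nil
  then show ?case by simp
next
  case (Cons M Ms)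
  interpret N: finite_q_matroid K "space N" "rk N" using N by (simp add: q_matroid_iff[OF K])
  have M: "q_matroid K M" using Cons.prems by simp
  interpret M: finite_q_matroid K "space M" "rk M" using M by (simp add: q_matroid_iff[OF K])
  note A = \<open>A \<in> subspaces K (space N)\<close>
  obtain B f where B: "B \<in> subspaces K (space N)" and AB: "A \<subset> B"
    and f: "minor_map K N A B M f" and fl: "flag K N B Ms"
    by (rule flag_ConsE[OF Cons.prems(4)])
  from f have lf: "linear_map K ((space N)\<lparr>carrier := B\<rparr>) (space M) f"
    and fB: "f ` B = carrier (space M)" and kf: "{x \<in> B. f x = \<zero>\<^bsub>space M\<^esub>} = A"
    and rf: "\<And>X. X \<in> subspaces K (space N) \<Longrightarrow> A \<subseteq> X \<Longrightarrow> X \<subseteq> B \<Longrightarrow> rk M (f ` X) = rk N X - rk N A"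
    by (simp_all add: minor_map_def)
  note BN = N.subspacesD[OF B]
  show ?case
  proof (cases Ms)
    case Nil
    let ?P = "transport (\<lambda>x. [x]) M"
    have inj: "inj (\<lambda>x. [x])" by (simp add: inj_on_def)
    note iso = transport_iso[OF inj M.vectorspace_axioms]
    have BE: "B = carrier (space N)" using fl by (simp add: Nil)
    let ?h = "\<lambda>x. [f x]"
    have f': "linear_map K (space N) (space M) f" using lf by (simp add: BE)
    have "linear_map K (space N) (space ?P) ?h"
      by (rule linear_map_comp[OF f' iso(1)])
    moreover have "?h ` carrier (space N) = carrier (space ?P)"
    proof -
      have "?h ` carrier (space N) = (\<lambda>x. [x]) ` f ` B" by (simp add: BE image_image)
      then show ?thesis using bij_betw_imp_surj_on[OF iso(2)] fB by simp
    qed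
    moreover have "{x \<in> carrier (space N). ?h x = \<zero>\<^bsub>space ?P\<^esub>} = A"
    proof -
      have "\<zero>\<^bsub>space ?P\<^esub> = [\<zero>\<^bsub>space M\<^esub>]" using linear_mapD(6)[OF iso(1)] by simp
      then show ?thesis using kf by (simp add: BE)
    qed
    moreover have "rk N X - rk N A \<le> rk ?P (?h ` X)" if X: "X \<in> subspaces K (space N)" "A \<subseteq> X" for X
    proof -
      have "?h ` X = (\<lambda>x. [x]) ` f ` X" by (simp add: image_image)
      then have "rk ?P (?h ` X) = rk M (f ` X)" by (simp only: iso(3))
      then show ?thesis using rf[OF X] N.subspacesD(1)[OF X(1)] by (simp add: BE)
    qed
    ultimately show ?thesis by (auto simp: Nil)
  next
    case (Cons M' Ms')
    let ?P' = "free_products K (M' # Ms')" and ?P = "free_products K (M # M' # Ms')"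
    let ?D = "direct_sum (space M) (space ?P')"
    have nz: "\<forall>M \<in> set (M' # Ms'). q_matroid K M \<and> carrier (space M) \<noteq> {\<zero>\<^bsub>space M\<^esub>}"
      using Cons.prems(2) by (simp add: Cons)
    have P': "q_matroid K ?P'"
      using free_products_flag[OF K _ nz] by simp
    interpret P': finite_q_matroid K "space ?P'" "rk ?P'" using P' by (simp add: q_matroid_iff[OF K])
    obtain t where t: "linear_map K ?D (space ?P) t"
      and bij: "bij_betw t (carrier ?D) (carrier (space ?P))"
      and rk: "\<And>X. X \<in> subspaces K ?D \<Longrightarrow> rk ?P (t ` X) = fp_rank K M ?P' X"
      by (rule free_products_Cons_iso[OF K M P']) blast
    obtain h where h: "linear_map K (space N) (space ?P') h"
      and hs: "h ` carrier (space N) = carrier (space ?P')"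
      and hk: "{x \<in> carrier (space N). h x = \<zero>\<^bsub>space ?P'\<^esub>} = B"
      and hr: "\<And>X. X \<in> subspaces K (space N) \<Longrightarrow> B \<subseteq> X \<Longrightarrow> rk N X - rk N B \<le> rk ?P' (h ` X)"
      using Cons.IH[unfolded Cons, OF _ nz B fl[unfolded Cons]] by blast
    \<comment> \<open>\<open>f\<close> is defined only on \<open>B\<close>; the freedom in choosing
      \<open>g\<close> outside \<open>B\<close> corresponds to the choice of a complement and does
      not affect the estimates below.\<close>
    obtain g where g: "linear_map K (space N) (space M) g" and gf: "\<And>x. x \<in> B \<Longrightarrow> g x = f x"
      by (rule N.linear_map_extend[OF B lf]) blast
    note gD = linear_mapD[OF g] and hD = linear_mapD[OF h]
    have hB: "h x = \<zero>\<^bsub>space ?P'\<^esub> \<longleftrightarrow> x \<in> B" if "x \<in> carrier (space N)" for x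
      using hk that by blast
    let ?p = "\<lambda>x. (g x, h x)"
    have p: "linear_map K (space N) ?D ?p" by (rule linear_map_pair[OF g h])
    have ps: "?p ` carrier (space N) = carrier ?D"
    proof (intro equalityI subsetI)
      fix z assume "z \<in> carrier ?D"
      then obtain u v where z: "z = (u, v)" "u \<in> carrier (space M)" "v \<in> carrier (space ?P')" by auto
      have "v \<in> h ` carrier (space N)" using z(3) by (simp only: hs)
      then obtain y where y: "v = h y" "y \<in> carrier (space N)" by (rule imageE)
      \<comment> \<open>A preimage y of v under \<open>h\<close> is corrected by an element b of
        \<open>B\<close>: this leaves the value of \<open>h\<close> alone, and \<open>f\<close> maps
        \<open>B\<close> onto the whole space of \<open>M\<close>.\<close>
      have "u \<ominus>\<^bsub>space M\<^esub> g y \<in> f ` B" using z(2) gD(3)[OF y(2)] fB by simp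
      then obtain b where b: "u \<ominus>\<^bsub>space M\<^esub> g y = f b" "b \<in> B" by (rule imageE)
      have bN: "b \<in> carrier (space N)" by (rule BN(6)[OF b(2)])
      have "g (y \<oplus>\<^bsub>space N\<^esub> b) = g y \<oplus>\<^bsub>space M\<^esub> (u \<ominus>\<^bsub>space M\<^esub> g y)"
        using gD(4)[OF y(2) bN] gf[OF b(2)] b(1) by simp
      also have "\<dots> = u"
        using gD(3)[OF y(2)] z(2) by (simp add: a_minus_def M.M.a_lcomm M.M.r_neg)
      finally have "?p (y \<oplus>\<^bsub>space N\<^esub> b) = z"
        using hD(4)[OF y(2) bN] hD(3)[OF y(2)] hB[OF bN] b(2) y z by simp
      then show "z \<in> ?p ` carrier (space N)"
        using y(2) bN by (intro image_eqI[of _ _ "y \<oplus>\<^bsub>space N\<^esub> b"]) simp_all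
    next
      fix z assume "z \<in> ?p ` carrier (space N)"
      then show "z \<in> carrier ?D" using gD(3) hD(3) by auto
    qed
    let ?h = "\<lambda>x. t (?p x)"
    have "linear_map K (space N) (space ?P) ?h" by (rule linear_map_comp[OF p t])
    moreover have "?h ` carrier (space N) = carrier (space ?P)"
    proof -
      have "?h ` carrier (space N) = t ` ?p ` carrier (space N)" by (simp only: image_image)
      then show ?thesis unfolding ps using bij_betw_imp_surj_on[OF bij] by simp
    qed
    moreover have "{x \<in> carrier (space N). ?h x = \<zero>\<^bsub>space ?P\<^esub>} = A"
    proof -
      have "?h x = \<zero>\<^bsub>space ?P\<^esub> \<longleftrightarrow> x \<in> A" if x: "x \<in> carrier (space N)" for x
      proof -
        have "?p x \<in> carrier ?D" "\<zero>\<^bsub>?D\<^esub> \<in> carrier ?D"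
          using linear_mapD(3)[OF p x] M.M.zero_closed P'.M.zero_closed by auto
        then have "t (?p x) = t \<zero>\<^bsub>?D\<^esub> \<longleftrightarrow> ?p x = \<zero>\<^bsub>?D\<^esub>"
          by (rule inj_on_eq_iff[OF bij_betw_imp_inj_on[OF bij]])
        then have "?h x = \<zero>\<^bsub>space ?P\<^esub> \<longleftrightarrow> g x = \<zero>\<^bsub>space M\<^esub> \<and> h x = \<zero>\<^bsub>space ?P'\<^esub>"
          using linear_mapD(6)[OF t] by simp
        also have "\<dots> \<longleftrightarrow> x \<in> A" using hB[OF x] gf[of x] kf AB by auto
        finally show ?thesis .
      qed
      then show ?thesis using N.subspacesD(1)[OF A] by auto
    qed
    moreover have "rk N X - rk N A \<le> rk ?P (?h ` X)" if X: "X \<in> subspaces K (space N)" "A \<subseteq> X" for X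
    proof -
      note XN = N.subspacesD[OF X(1)]
      have pX: "?p ` X \<in> subspaces K ?D" by (rule image_in_subspaces[OF p X(1)])
      have "rk ?P (?h ` X) = fp_rank K M ?P' (?p ` X)"
        using rk[OF pX] by (simp add: image_image)
      moreover have "snd ` ?p ` X = h ` X" by (simp add: image_image)
      \<comment> \<open>A second entry of zero forces x into the kernel \<open>B\<close> of
        \<open>h\<close>, where \<open>g\<close> agrees with \<open>f\<close>.\<close>
      moreover have "left_part (space M) (space ?P') (?p ` X) = f ` (X \<inter> B)"
      proof (intro equalityI subsetI)
        fix u assume "u \<in> left_part (space M) (space ?P') (?p ` X)"
        then obtain x where x: "x \<in> X" "u = g x" "h x = \<zero>\<^bsub>space ?P'\<^esub>"
          by (auto simp: mem_left_part_iff)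
        then have "x \<in> B" using hB XN(6) by blast
        then show "u \<in> f ` (X \<inter> B)" using x gf by auto
      next
        fix u assume "u \<in> f ` (X \<inter> B)"
        then obtain x where x: "x \<in> X" "x \<in> B" "u = g x" using gf by auto
        then have "h x = \<zero>\<^bsub>space ?P'\<^esub>" "u \<in> carrier (space M)" using hB XN(6) gD(3) by auto
        then show "u \<in> left_part (space M) (space ?P') (?p ` X)"
          using x by (force simp: mem_left_part_iff)
      qed
      \<comment> \<open>First bound: enlarge \<open>X\<close> to \<open>X + B\<close>. The image
        under \<open>h\<close> does not grow because \<open>h\<close> kills \<open>B\<close>, and
        the step from \<open>A\<close> to \<open>B\<close> accounts for the full rank of
        \<open>M\<close>.\<close>
      moreover have "rk N X - rk N A \<le> rk M (carrier (space M)) + rk ?P' (h ` X)"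
      proof -
        let ?S = "N.subspace_sum X B"
        have S: "?S \<in> subspaces K (space N)" by (rule N.subspace_sum_in_subspaces[OF X(1) B])
        note SX = N.subspace_sum_upper[OF X(1) B]
        have hX: "h ` X \<in> subspaces K (space ?P')" by (rule image_in_subspaces[OF h X(1)])
        have "h ` B \<subseteq> {\<zero>\<^bsub>space ?P'\<^esub>}" using hB BN(6) by auto
        then have "h ` ?S \<subseteq> h ` X"
          unfolding image_subspace_sum[OF h X(1) B]
          using P'.subspacesD(2)[OF hX] by (intro P'.subspace_sum_least[OF _ _ hX]) auto
        then have "rk ?P' (h ` ?S) \<le> rk ?P' (h ` X)"
          by (rule P'.rank_mono[OF image_in_subspaces[OF h S] hX])
        moreover have "rk N X \<le> rk N ?S" by (rule N.rank_mono[OF X(1) S SX(1)])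
        moreover have "rk M (carrier (space M)) = rk N B - rk N A"
          using rf[OF B] AB fB by auto
        ultimately show ?thesis using hr[OF S SX(2)] by linarith
      qed
      \<comment> \<open>Second bound: pass from \<open>X \<inter> B\<close> to \<open>X\<close>. The
        rank grows by at most the difference of dimensions, which is the dimension of the image of
        \<open>X\<close> under \<open>h\<close>.\<close>
      moreover have "rk N X - rk N A \<le> rk M (f ` (X \<inter> B)) + sdim K (space ?P') (h ` X)"
      proof -
        have XB: "X \<inter> B \<in> subspaces K (space N)" by (rule N.Int_in_subspaces[OF X(1) B])
        have "{x \<in> X. h x = \<zero>\<^bsub>space ?P'\<^esub>} = X \<inter> B" using hB XN(6) by blast
        then have "sdim K (space N) X = sdim K (space ?P') (h ` X) + sdim K (space N) (X \<inter> B)"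
          using N.sdim_rank_nullity[OF h X(1)] by simp
        moreover have "rk M (f ` (X \<inter> B)) = rk N (X \<inter> B) - rk N A"
          using rf[OF XB] X(2) AB by auto
        ultimately show ?thesis using N.rank_increment_le[OF XB X(1)] by simp
      qed
      ultimately show ?thesis by (simp add: fp_rank_def)
    qed
    ultimately show ?thesis unfolding Cons by blast
  qed
qed

theorem corollary4p13:
  fixes K :: "('k, 'x) ring_scheme"
    and Ms :: "('k, 'v) qmat list"
  assumes "field K" and "finite (carrier K)"
    and "Ms \<noteq> []"
    and "\<forall>M \<in> set Ms. q_matroid K M \<and> carrier (space M) \<noteq> {\<zero>\<^bsub>space M\<^esub>}"
  shows "free_products K Ms \<in> Mq K Ms \<and>
         (\<forall>N :: ('k, 'w) qmat. N \<in> Mq K Ms \<and> weak_le K (free_products K Ms) N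
            \<longrightarrow> qm_iso K N (free_products K Ms))"
proof (intro conjI allI impI)
  note K = assms(2)
  let ?P = "free_products K Ms"
  have P: "q_matroid K ?P" "flag K ?P {\<zero>\<^bsub>space ?P\<^esub>} Ms"
    using free_products_flag[OF K assms(3,4)] by auto
  then show "?P \<in> Mq K Ms" by (simp add: Mq_iff)
  interpret P: finite_q_matroid K "space ?P" "rk ?P" using P(1) by (simp add: q_matroid_iff[OF K])
  fix N :: "('k, 'w) qmat"
  assume "N \<in> Mq K Ms \<and> weak_le K ?P N"
  then have N: "q_matroid K N" "flag K N {\<zero>\<^bsub>space N\<^esub>} Ms" and le: "weak_le K ?P N"
    by (auto simp: Mq_iff)
  interpret N: finite_q_matroid K "space N" "rk N" using N(1) by (simp add: q_matroid_iff[OF K])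
  let ?S = "subspaces K (space N)"
  obtain h where h: "linear_map K (space N) (space ?P) h"
    and hs: "h ` carrier (space N) = carrier (space ?P)"
    and hk: "{x \<in> carrier (space N). h x = \<zero>\<^bsub>space ?P\<^esub>} = {\<zero>\<^bsub>space N\<^esub>}"
    and hr: "\<And>X. X \<in> ?S \<Longrightarrow> {\<zero>\<^bsub>space N\<^esub>} \<subseteq> X \<Longrightarrow> rk N X - rk N {\<zero>\<^bsub>space N\<^esub>} \<le> rk ?P (h ` X)"
    using free_products_dominates[OF K N(1) assms(3,4) N.zero_in_subspaces N(2)] by blast
  \<comment> \<open>The flag of \<open>N\<close> starts at zero, so the map it yields has trivial
    kernel.\<close>
  have "carrier ((space N)\<lparr>carrier := mod_hom.ker (space N) (space ?P) h\<rparr>) = {\<zero>\<^bsub>space N\<^esub>}"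
    unfolding mod_hom.ker_def[OF linear_map.axioms(3)[OF h]] using hk by simp
  then have inj: "inj_on h (carrier (space N))" by (rule linear_map.Ke0_imp_inj[OF h])
  then have bij: "bij_betw h (carrier (space N)) (carrier (space ?P))"
    using hs by (simp add: bij_betw_def)
  have hle: "rk N X \<le> rk ?P (h ` X)" if "X \<in> ?S" for X
    using hr[OF that] N.subspacesD(2)[OF that] N.rank_zero by simp
  have hbij: "bij_betw ((`) h) ?S (subspaces K (space ?P))"
    unfolding bij_betw_def
  proof
    show "inj_on ((`) h) ?S"
      by (rule inj_onI) (metis inj inj_on_image_eq_iff N.subspacesD(1))
    show "(`) h ` ?S = subspaces K (space ?P)"
    proof (intro equalityI subsetI)
      fix Y assume Y: "Y \<in> subspaces K (space ?P)"
      show "Y \<in> (`) h ` ?S"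
        by (rule image_eqI[where x = "{x \<in> carrier (space N). h x \<in> Y}"])
          (simp_all only: image_vimage_bij[OF bij P.subspacesD(1)[OF Y]] vimage_in_subspaces[OF h Y])
    next
      fix Y assume "Y \<in> (`) h ` ?S"
      then show "Y \<in> subspaces K (space ?P)" using image_in_subspaces[OF h] by auto
    qed
  qed
  \<comment> \<open>\<open>weak_le\<close> provides a map from the larger q-matroid to the smaller
    one, here from subspaces of \<open>N\<close> to subspaces of the product. This is also the
    direction of \<open>h\<close>, so both reindex the same sum.\<close>
  obtain s where s: "bij_betw s ?S (subspaces K (space ?P))"
    and sle: "\<And>X. X \<in> ?S \<Longrightarrow> rk ?P (s X) \<le> rk N X"
    using le by (auto simp: weak_le_def lattice_iso_def)
  have "(\<Sum>X\<in>?S. rk ?P (h ` X)) = (\<Sum>Y\<in>subspaces K (space ?P). rk ?P Y)"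
    by (rule sum.reindex_bij_betw[OF hbij])
  also have "\<dots> = (\<Sum>X\<in>?S. rk ?P (s X))"
    by (rule sum.reindex_bij_betw[OF s, symmetric])
  also have "\<dots> \<le> (\<Sum>X\<in>?S. rk N X)" by (rule sum_mono[OF sle])
  finally have "(\<Sum>X\<in>?S. rk N X) = (\<Sum>X\<in>?S. rk ?P (h ` X))"
    using sum_mono[of ?S "rk N" "\<lambda>X. rk ?P (h ` X)", OF hle] by linarith
  \<comment> \<open>\<open>hle\<close> compares the summands one by one; with equal finite sums no
    single comparison can be strict.\<close>
  then have "rk N X = rk ?P (h ` X)" if "X \<in> ?S" for X
    by (rule sum_mono_inv[OF _ hle that N.finite_subspaces])
  \<comment> \<open>The witness is the linear bijection \<open>h\<close>; \<open>s\<close> served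
    only to compare the sums.\<close>
  then show "qm_iso K N ?P"
    unfolding qm_iso_def using h bij by (intro exI[of _ h]) simp
qed

end
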